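(* Let $d\ge2$, $1\le M\le d$ and $N\ge2$ be integers, and let $S_{\mathbf a,\mathbf b}\subset\mathbb R^d$ be the two-row Hermite normal form simplex associated with $\mathbf a=(1,\ldots,1,N)$ and $\mathbf b=(M-1,\ldots,M-1,M,0)$. Then the following are equivalent: (1) $M\in\{d-1,d\}$; (2) $S_{\mathbf a,\mathbf b}$ admits a unimodular triangulation; (3) $S_{\mathbf a,\mathbf b}$ has the integer decomposition property.
   Context: For $\mathbf b=(b_1,\ldots,b_{d-2},M,0)$ and $\mathbf a=(a_1,\ldots,a_{d-1},N)$ in $\mathbb Z^d$, the two-row Hermite normal form simplex $S_{\mathbf a,\mathbf b}$ is the convex hull in $\mathbb R^d$ of $\mathbf v_0=\mathbf 0$, $\mathbf v_i=\mathbf e_i$ (standard unit vectors) for $1\le i\le d-2$, $\mathbf v_{d-1}=\mathbf b$, and $\mathbf v_d=\mathbf a$. In $\mathbf b=(M-1,\ldots,M-1,M,0)$ the first $d-2$ entries equal $M-1$; in $\mathbf a=(1,\ldots,1,N)$ the first $d-1$ entries equal $1$. A (lattice) triangulation of a $d$-dimensional lattice polytope $P\subset\mathbb R^d$ is a collection of $d$-dimensional lattice simplices (vertices in $\mathbb Z^d$) whose union is $P$ and such that any two intersect in a common face. It is unimodular if every simplex in it has normalized volume ($d!$ times Euclidean volume) equal to $1$. $P$ has the integer decomposition property if for every positive integer $m$ and every $\mathbf p\in mP\cap\mathbb Z^d$ there are $\mathbf p_1,\ldots,\mathbf p_m\in P\cap\mathbb Z^d$ with $\mathbf p=\mathbf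 p_1+\cdots+\mathbf p_m$. *)

theory Defs
  imports "HOL-Analysis.Analysis"
begin

text \<open>
  The ambient space is \<open>real ^ 'n\<close>, so \<open>d = CARD('n)\<close>. As the index type carries no order,
  the numbering of the coordinates by \<open>1, \<dots>, d\<close> is an explicit parameter
  \<open>\<iota> :: nat \<Rightarrow> 'n\<close>, which is meant to satisfy \<open>bij_betw \<iota> {1..CARD('n)} UNIV\<close>:
  coordinate \<open>\<iota> i\<close> is the \<open>i\<close>-th one.
\<close>

definition std_unit :: "(nat \<Rightarrow> 'n::finite) \<Rightarrow> nat \<Rightarrow> real ^ 'n" where
  "std_unit \<iota> i = axis (\<iota> i) 1"

text \<open>The vector \<open>(x 1, \<dots>, x d)\<close>; values of \<open>x\<close> outside \<open>{1..d}\<close> are ignored.\<close>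

definition int_vec :: "(nat \<Rightarrow> 'n::finite) \<Rightarrow> (nat \<Rightarrow> int) \<Rightarrow> real ^ 'n" where
  "int_vec \<iota> x = (\<Sum>i = 1..CARD('n). real_of_int (x i) *\<^sub>R std_unit \<iota> i)"

definition two_row_hnf_simplex ::
    "(nat \<Rightarrow> 'n::finite) \<Rightarrow> (nat \<Rightarrow> int) \<Rightarrow> (nat \<Rightarrow> int) \<Rightarrow> (real ^ 'n) set" where
  "two_row_hnf_simplex \<iota> a b =
     convex hull ({0} \<union> std_unit \<iota> ` {1..CARD('n) - 2} \<union> {int_vec \<iota> b, int_vec \<iota> a})"

definition lattice_points :: "(real ^ 'n::finite) set" where
  "lattice_points = {x. \<forall>k. x $ k \<in> \<int>}"

definition full_lattice_simplex :: "(real ^ 'n::finite) set \<Rightarrow> bool" where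
  "full_lattice_simplex T \<longleftrightarrow>
     int CARD('n) simplex T \<and> {v. v extreme_point_of T} \<subseteq> lattice_points"

text \<open>
  The library's \<^const>\<open>triangulation\<close> supplies finiteness and the condition that any two members
  meet in a common (possibly empty) face.
\<close>

definition lattice_triangulation ::
    "(real ^ 'n::finite) set set \<Rightarrow> (real ^ 'n) set \<Rightarrow> bool" where
  "lattice_triangulation \<T> P \<longleftrightarrow>
     triangulation \<T> \<and> (\<forall>T\<in>\<T>. full_lattice_simplex T) \<and> \<Union>\<T> = P"

definition normalized_volume :: "(real ^ 'n::finite) set \<Rightarrow> real" where
  "normalized_volume T = fact CARD('n) * measure lebesgue T"

definition unimodular_triangulation ::
    "(real ^ 'n::finite) set set \<Rightarrow> (real ^ 'n) set \<Rightarrow> bool" where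
  "unimodular_triangulation \<T> P \<longleftrightarrow>
     lattice_triangulation \<T> P \<and> (\<forall>T\<in>\<T>. normalized_volume T = 1)"

definition integer_decomposition_property :: "(real ^ 'n::finite) set \<Rightarrow> bool" where
  "integer_decomposition_property P \<longleftrightarrow>
     (\<forall>m\<ge>1. \<forall>p \<in> (\<lambda>x. real m *\<^sub>R x) ` P \<inter> lattice_points.
        \<exists>q :: nat \<Rightarrow> real ^ 'n.
          (\<forall>i\<in>{1..m}. q i \<in> P \<inter> lattice_points) \<and> p = (\<Sum>i = 1..m. q i))"

end

theory Submission
  imports Defs
begin

text \<open>
  If \<open>M \<in> {d - 1, d}\<close>, then \<open>c = (1, \<dots>, 1, 0)\<close> is the barycentre of \<open>M\<close> of the vertices
  \<open>v\<^sub>0, \<dots>, v\<^bsub>d-1\<^esub>\<close> and the apex \<open>a\<close> lies at height \<open>N\<close> above \<open>c\<close>. Starring from \<open>c\<close> and cutting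
  the segment from \<open>c\<close> to \<open>a\<close> at its lattice points gives simplices in which every lattice point
  has integral barycentric coordinates. This yields unimodularity, and also the integer
  decomposition property, because a point of \<open>m S\<close> lies in the \<open>m\<close>-th dilate of one of them.

  If \<open>M \<le> d - 2\<close>, the barycentric coordinates of a lattice point with respect to
  \<open>v\<^sub>1, \<dots>, v\<^bsub>d-1\<^esub>\<close> agree modulo 1, which forces every lattice point of \<open>S\<close> to be a vertex. Then \<open>S\<close>
  itself would be the only simplex of a triangulation, but its normalized volume is divisible
  by \<open>N\<close>; and all sums of lattice points of \<open>S\<close> have last coordinate divisible by \<open>N\<close>, whereas
  \<open>(1, \<dots>, 1, N - 1)\<close> lies in \<open>d S\<close>.
\<close>

section \<open>Volumes of lattice simplices\<close>

text \<open>
  The library computes volumes of linear images in \<open>real ^ 'n\<close> only for well-ordered index types.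
  A copy of \<open>'n\<close> with an arbitrary well-order, and the relabelling of coordinates, remove
  this restriction.
\<close>

typedef 'a ordered_copy = "UNIV :: 'a set" by auto

instance ordered_copy :: (finite) finite
proof
  have "finite (range (Abs_ordered_copy :: 'a \<Rightarrow> 'a ordered_copy))"
    by simp
  also have "range (Abs_ordered_copy :: 'a \<Rightarrow> 'a ordered_copy) = UNIV"
    by (rule surjI[of _ Rep_ordered_copy]) (rule Rep_ordered_copy_inverse)
  finally show "finite (UNIV :: 'a ordered_copy set)" .
qed

definition enum_index :: "'a::finite \<Rightarrow> nat" where
  "enum_index = (SOME f. inj f)"

lemma inj_enum_index: "inj (enum_index :: 'a::finite \<Rightarrow> nat)"
  unfolding enum_index_def
  using finite_imp_inj_to_nat_seg[OF finite_class.finite_UNIV] by (intro someI_ex[of inj]) blast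

instantiation ordered_copy :: (finite) wellorder
begin

definition "x \<le> y \<longleftrightarrow> enum_index (Rep_ordered_copy x) \<le> enum_index (Rep_ordered_copy y)"
definition "x < y \<longleftrightarrow> enum_index (Rep_ordered_copy x) < enum_index (Rep_ordered_copy y)"

instance
proof
  fix x y :: "'a ordered_copy"
  assume "x \<le> y" "y \<le> x"
  then have "enum_index (Rep_ordered_copy x) = enum_index (Rep_ordered_copy y)"
    by (simp add: less_eq_ordered_copy_def)
  then show "x = y"
    by (metis inj_enum_index injD Rep_ordered_copy_inject)
next
  fix P :: "'a ordered_copy \<Rightarrow> bool" and a
  assume step: "\<And>x. (\<And>y. y < x \<Longrightarrow> P y) \<Longrightarrow> P x"
  show "P a"
    by (induction a rule: measure_induct_rule[of "\<lambda>x. enum_index (Rep_ordered_copy x)"])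
      (use step in \<open>simp add: less_ordered_copy_def\<close>)
qed (auto simp: less_eq_ordered_copy_def less_ordered_copy_def)

end

lemma bij_Rep_ordered_copy: "bij Rep_ordered_copy"
  by (rule o_bij[of Abs_ordered_copy])
    (simp_all add: fun_eq_iff Rep_ordered_copy_inverse Abs_ordered_copy_inverse)

lemma all_ordered_copy: "(\<forall>i. P (Rep_ordered_copy i)) \<longleftrightarrow> (\<forall>k. P k)"
proof (intro iffI allI)
  fix k
  assume "\<forall>i. P (Rep_ordered_copy i)"
  then have "P (Rep_ordered_copy (Abs_ordered_copy k))"
    by blast
  then show "P k"
    by (simp add: Abs_ordered_copy_inverse)
qed blast

lemma card_ordered_copy: "CARD('n::finite ordered_copy) = CARD('n)"
  using bij_betw_same_card[OF bij_Rep_ordered_copy] .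

definition relabel :: "real ^ 'n::finite \<Rightarrow> real ^ 'n ordered_copy" where
  "relabel x = (\<chi> i. x $ Rep_ordered_copy i)"

lemma relabel_nth [simp]: "relabel x $ i = x $ Rep_ordered_copy i"
  by (simp add: relabel_def)

lemma linear_relabel: "linear relabel"
  by (rule linearI) (simp_all add: vec_eq_iff)

lemma bij_relabel: "bij relabel"
proof (rule bijI)
  show "inj relabel"
  proof (rule injI)
    fix x y :: "real ^ 'n"
    assume "relabel x = relabel y"
    then have "\<forall>i. x $ Rep_ordered_copy i = y $ Rep_ordered_copy i"
      by (simp add: vec_eq_iff)
    then show "x = y"
      using all_ordered_copy[of "\<lambda>k. x $ k = y $ k"] by (simp add: vec_eq_iff)
  qed
  show "surj relabel"
    by (rule surjI[where f = "\<lambda>y. \<chi> i. y $ Abs_ordered_copy i"])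
      (simp add: vec_eq_iff Rep_ordered_copy_inverse)
qed

lemma relabel_lattice_points: "relabel x \<in> lattice_points \<longleftrightarrow> x \<in> lattice_points"
  using all_ordered_copy[of "\<lambda>k. x $ k \<in> \<int>"] by (simp add: lattice_points_def)

text \<open>Relabelling permutes the edges of a box and so keeps the product of their lengths;
  agreement with Lebesgue measure on boxes determines the measure.\<close>

lemma lborel_relabel: "distr lborel borel relabel = (lborel :: (real ^ 'n::finite ordered_copy) measure)"
proof (rule lborel_eqI[symmetric])
  fix l u :: "real ^ 'n ordered_copy"
  assume le: "\<And>b. b \<in> Basis \<Longrightarrow> l \<bullet> b \<le> u \<bullet> b"
  define inv_relabel where "inv_relabel y = (\<chi> i. y $ Abs_ordered_copy i)"
    for y :: "real ^ 'n ordered_copy"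
  have le': "l $ i \<le> u $ i" for i
    using le[of "axis i 1"] by (simp add: inner_axis)
  have meas: "relabel \<in> borel_measurable borel"
    by (intro borel_measurable_continuous_onI linear_continuous_on linear_relabel[THEN linear_conv_bounded_linear[THEN iffD1]])
  have box: "relabel -` box l u = box (inv_relabel l) (inv_relabel u)"
    using all_ordered_copy[of "\<lambda>k. inv_relabel l $ k < x $ k \<and> x $ k < inv_relabel u $ k" for x]
    by (auto simp: mem_box_cart inv_relabel_def Rep_ordered_copy_inverse)
  have prod: "(\<Prod>b\<in>Basis. (v - w) \<bullet> b) = (\<Prod>i\<in>UNIV. v $ i - w $ i)" for v w :: "real ^ 'k"
  proof -
    have "Basis = range (\<lambda>i::'k. axis i (1::real))"
      by (auto simp: Basis_vec_def)
    moreover have inj: "inj (\<lambda>i::'k. axis i (1::real))"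
      by (simp add: inj_on_def axis_eq_axis)
    ultimately have "(\<Prod>b\<in>Basis. (v - w) \<bullet> b) = (\<Prod>b\<in>range (\<lambda>i::'k. axis i 1). (v - w) \<bullet> b)"
      by (simp only:)
    also have "\<dots> = (\<Prod>i\<in>UNIV. v $ i - w $ i)"
      unfolding prod.reindex[OF inj] by (simp add: inner_axis)
    finally show ?thesis .
  qed
  have "emeasure (distr lborel borel relabel) (box l u)
      = emeasure lborel (box (inv_relabel l) (inv_relabel u))"
    by (subst emeasure_distr) (simp_all add: meas box)
  also have "\<dots> = (\<Prod>b\<in>Basis. (inv_relabel u - inv_relabel l) \<bullet> b)"
    by (rule emeasure_lborel_box)
      (auto simp: Basis_vec_def inner_axis inv_relabel_def le')
  also have "(\<Prod>b\<in>Basis. (inv_relabel u - inv_relabel l) \<bullet> b)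
      = (\<Prod>i\<in>UNIV. u $ Abs_ordered_copy i - l $ Abs_ordered_copy i)"
    by (subst prod) (simp add: inv_relabel_def)
  also have "\<dots> = (\<Prod>i\<in>UNIV. u $ i - l $ i)"
    by (rule prod.reindex_bij_witness[of _ Rep_ordered_copy Abs_ordered_copy])
      (simp_all add: Rep_ordered_copy_inverse Abs_ordered_copy_inverse)
  also have "\<dots> = (\<Prod>b\<in>Basis. (u - l) \<bullet> b)"
    by (rule prod[symmetric])
  finally show "emeasure (distr lborel borel relabel) (box l u) = (\<Prod>b\<in>Basis. (u - l) \<bullet> b)" .
qed simp

text \<open>Compact sets are Borel, so \<open>measure lebesgue\<close> can be exchanged for
  \<open>measure lborel\<close> on both sides, where \<open>lborel_relabel\<close> applies.\<close>

lemma normalized_volume_relabel: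
  assumes "compact K"
  shows "normalized_volume (relabel ` K) = normalized_volume K"
proof -
  have cont: "continuous_on A relabel" for A
    by (intro linear_continuous_on linear_relabel[THEN linear_conv_bounded_linear[THEN iffD1]])
  have "compact (relabel ` K)"
    using assms cont by (rule compact_continuous_image[rotated])
  then have "measure lebesgue (relabel ` K) = measure lborel (relabel ` K)"
    by (intro measure_completion) (auto dest: compact_imp_closed)
  also have "\<dots> = measure (distr lborel borel relabel) (relabel ` K)"
    by (simp add: lborel_relabel)
  also have "\<dots> = measure lborel (relabel -` (relabel ` K))"
    using \<open>compact (relabel ` K)\<close>
    by (subst measure_distr)
      (auto intro: borel_measurable_continuous_onI[OF cont] dest: compact_imp_closed)
  also have "relabel -` (relabel ` K) = K"
    using bij_relabel by (metis bij_def inj_vimage_image_eq)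
  also have "measure lborel K = measure lebesgue K"
    using assms by (intro measure_completion[symmetric]) (auto dest: compact_imp_closed)
  finally show ?thesis
    by (simp add: normalized_volume_def card_ordered_copy)
qed

section \<open>Normalized volume as an integral determinant\<close>

lemma det_Ints:
  fixes A :: "real ^ 'n ^ 'n"
  assumes "\<And>i j. A $ i $ j \<in> \<int>"
  shows "det A \<in> \<int>"
  unfolding det_def using assms by (intro Ints_sum Ints_mult Ints_prod) auto

lemma normalized_volume_simplex:
  fixes X :: "(real ^ 'n::{finite, wellorder}) set"
  assumes "finite X" "card X = Suc CARD('n)" "x0 \<in> X"
    and "bij_betw f (UNIV :: 'n set) (X - {x0})"
  shows "normalized_volume (convex hull X) = \<bar>det (\<chi> i j. f j $ i - x0 $ i)\<bar>"
proof -
  have "measure lebesgue (convex hull X) = measure lborel (convex hull X)"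
    using compact_imp_closed[OF finite_imp_compact_convex_hull[OF assms(1)]]
    by (intro measure_completion) simp
  then show ?thesis
    using content_simplex[OF assms] by (simp add: normalized_volume_def)
qed

lemma enumerate_other_vertices:
  fixes X :: "(real ^ 'n::finite) set"
  assumes "finite X" "card X = Suc CARD('n)" "x0 \<in> X"
  obtains f where "bij_betw f (UNIV :: 'n set) (X - {x0})"
proof -
  have "card (UNIV :: 'n set) = card (X - {x0})"
    using assms by simp
  then show ?thesis
    using finite_same_card_bij[of "UNIV :: 'n set" "X - {x0}"] assms(1) that by auto
qed

text \<open>Row \<open>k\<close> of the matrix of edge vectors at \<open>x0\<close> is
  \<open>N\<close> times an integral row and the other rows are integral, so the determinant is a
  multiple of \<open>N\<close>.\<close>

lemma normalized_volume_integer_multiple: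
  fixes X :: "(real ^ 'n::finite) set"
  assumes "finite X" "card X = Suc CARD('n)" "x0 \<in> X" "X \<subseteq> lattice_points"
    and multiple: "\<And>x. x \<in> X \<Longrightarrow> \<exists>z. x $ k - x0 $ k = of_int (N * z)"
  shows "\<exists>z. normalized_volume (convex hull X) = of_int (N * z)"
proof -
  define Y where "Y = relabel ` X"
  define k' where "k' = Abs_ordered_copy k"
  define y0 where "y0 = relabel x0"
  have inj: "inj_on relabel X"
    using bij_relabel by (meson bij_def inj_on_subset subset_UNIV)
  have Y: "finite Y" "card Y = Suc CARD('n ordered_copy)" "y0 \<in> Y"
    using assms by (auto simp: Y_def y0_def card_image[OF inj] card_ordered_copy)
  obtain f where f: "bij_betw f (UNIV :: 'n ordered_copy set) (Y - {y0})"
    using enumerate_other_vertices Y by blast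
  have fY: "f j \<in> Y" for j
    using f by (auto simp: bij_betw_def)
  have int: "f j $ i - y0 $ i \<in> \<int>" for i j
    using fY[of j] assms(3,4) by (auto simp: Y_def y0_def lattice_points_def subset_iff)
  have "\<exists>z. f j $ k' - y0 $ k' = of_int (N * z)" for j
    using fY[of j] multiple
    by (auto simp: Y_def y0_def k'_def Abs_ordered_copy_inverse)
  then obtain z where z: "\<And>j. f j $ k' - y0 $ k' = of_int N * of_int (z j)"
    by (metis of_int_mult)
  \<comment> \<open>\<open>A\<close> is the edge matrix with the factor \<open>N\<close> taken out
    of row \<open>k'\<close>.\<close>
  define A :: "real ^ 'n ordered_copy ^ 'n ordered_copy" where
    "A = (\<chi> i. if i = k' then (\<chi> j. of_int (z j)) else (\<chi> j. f j $ i - y0 $ i))"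
  have "(\<chi> i j. f j $ i - y0 $ i)
      = (\<chi> i. if i = k' then of_int N *s (\<chi> j. of_int (z j)) else (\<chi> j. f j $ i - y0 $ i))"
    by (simp add: vec_eq_iff z)
  then have "det (\<chi> i j. f j $ i - y0 $ i) = of_int N * det A"
    by (simp only: A_def det_row_mul)
  moreover have "det A \<in> \<int>"
    by (rule det_Ints) (auto simp: A_def int)
  then obtain c where "det A = of_int c"
    by (auto elim: Ints_cases)
  ultimately have "normalized_volume (convex hull Y) = of_int \<bar>N * c\<bar>"
    using normalized_volume_simplex[OF Y f] by (simp add: abs_mult)
  moreover have "normalized_volume (convex hull Y) = normalized_volume (convex hull X)"
    unfolding Y_def convex_hull_linear_image[OF linear_relabel, symmetric]
    using assms(1) by (intro normalized_volume_relabel finite_imp_compact_convex_hull)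
  \<comment> \<open>\<open>N\<close> may have either sign; the absolute value is absorbed by the
    witness.\<close>
  moreover have "\<bar>N * c\<bar> = N * (if 0 \<le> N then \<bar>c\<bar> else - \<bar>c\<bar>)"
    by (simp add: abs_mult)
  ultimately show ?thesis
    by metis
qed

text \<open>The integral affine coefficients of the points \<open>y0 + axis k 1\<close> are the
  columns of an integral inverse of the edge matrix at \<open>y0\<close>. Two integers with product
  1 are units, so the determinant is 1 or -1.\<close>

lemma normalized_volume_unimodular:
  fixes X :: "(real ^ 'n::finite) set"
  assumes "finite X" "card X = Suc CARD('n)" "X \<subseteq> lattice_points"
    and generates: "\<And>y. y \<in> lattice_points \<Longrightarrow>
      \<exists>c :: real ^ 'n \<Rightarrow> int. sum c X = 1 \<and> (\<Sum>x\<in>X. of_int (c x) *\<^sub>R x) = y"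
  shows "normalized_volume (convex hull X) = 1"
proof -
  define Y where "Y = relabel ` X"
  have inj: "inj_on relabel X"
    using bij_relabel by (meson bij_def inj_on_subset subset_UNIV)
  have finY: "finite Y" and cardY: "card Y = Suc CARD('n ordered_copy)"
    using assms by (auto simp: Y_def card_image[OF inj] card_ordered_copy)
  then obtain y0 where y0: "y0 \<in> Y"
    by (metis card.empty ex_in_conv nat.distinct(1))
  obtain f where f: "bij_betw f (UNIV :: 'n ordered_copy set) (Y - {y0})"
    using enumerate_other_vertices finY cardY y0 by blast
  have fY: "f j \<in> Y" for j
    using f by (auto simp: bij_betw_def)
  have latY: "y \<in> lattice_points" if "y \<in> Y" for y
    using that assms(3) by (auto simp: Y_def relabel_lattice_points)
  have gen: "\<exists>c :: _ \<Rightarrow> int. sum c Y = 1 \<and> (\<Sum>x\<in>Y. of_int (c x) *\<^sub>R x) = y"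
    if "y \<in> lattice_points" for y
  proof -
    obtain x where x: "y = relabel x"
      using bij_relabel by (metis bij_def surj_def)
    then have "x \<in> lattice_points"
      using that by (simp add: relabel_lattice_points)
    then obtain c :: "_ \<Rightarrow> int" where c: "sum c X = 1" "(\<Sum>x\<in>X. of_int (c x) *\<^sub>R x) = x"
      using generates by blast
    have "inv relabel (relabel z) = z" for z :: "real ^ 'n"
      by (rule inv_f_f[OF bij_is_inj[OF bij_relabel]])
    then have "sum (c \<circ> inv relabel) Y = 1 \<and> (\<Sum>x\<in>Y. of_int ((c \<circ> inv relabel) x) *\<^sub>R x) = y"
      using c unfolding Y_def x sum.reindex[OF inj]
      by (simp add: o_def linear_sum[OF linear_relabel, symmetric]
          linear_cmul[OF linear_relabel, symmetric] del: linear_scale)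
    then show ?thesis by blast
  qed
  define A :: "real ^ 'n ordered_copy ^ 'n ordered_copy" where "A = (\<chi> i j. f j $ i - y0 $ i)"
  have "\<forall>k. \<exists>c :: _ \<Rightarrow> int. sum c Y = 1 \<and> (\<Sum>x\<in>Y. of_int (c x) *\<^sub>R x) = y0 + axis k 1"
    using latY[OF y0] by (intro allI gen) (auto simp: lattice_points_def axis_def)
  from choice[OF this] obtain c :: "'n ordered_copy \<Rightarrow> _ \<Rightarrow> int" where
      c: "\<And>k. sum (c k) Y = 1" "\<And>k. (\<Sum>x\<in>Y. of_int (c k x) *\<^sub>R x) = y0 + axis k 1"
    by blast
  define B :: "real ^ 'n ordered_copy ^ 'n ordered_copy" where "B = (\<chi> j k. of_int (c k (f j)))"
  have "(\<Sum>j\<in>UNIV. (f j $ i - y0 $ i) * of_int (c k (f j))) = axis k 1 $ i" for i k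
  proof -
    have "(\<Sum>j\<in>UNIV. (f j $ i - y0 $ i) * of_int (c k (f j)))
        = (\<Sum>x\<in>Y - {y0}. (x $ i - y0 $ i) * of_int (c k x))"
      by (rule sum.reindex_bij_betw[OF f])
    \<comment> \<open>The summand at \<open>y0\<close> is zero whatever its coefficient, so
      \<open>y0\<close> can be put back; the full sum of the coefficients, which is 1, then appears
      as the factor of \<open>y0\<close>.\<close>
    also have "\<dots> = (\<Sum>x\<in>Y. (x $ i - y0 $ i) * of_int (c k x))"
      by (simp add: sum.remove[OF finY y0])
    also have "\<dots> = (\<Sum>x\<in>Y. of_int (c k x) *\<^sub>R x) $ i - y0 $ i * of_int (sum (c k) Y)"
      by (simp add: algebra_simps sum_subtractf sum_distrib_left)
    finally show ?thesis
      by (simp add: c)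
  qed
  then have "A ** B = mat 1"
    by (simp add: vec_eq_iff A_def B_def matrix_matrix_mult_def mat_def axis_def)
  then have "det A * det B = 1"
    by (metis det_mul det_I)
  moreover have "det A \<in> \<int>" "det B \<in> \<int>"
    using latY fY y0 by (auto intro!: det_Ints Ints_diff simp: A_def B_def lattice_points_def)
  then obtain a b where ab: "det A = of_int a" "det B = of_int b"
    by (auto elim!: Ints_cases)
  ultimately have "a * b = 1"
    by (metis of_int_eq_1_iff of_int_mult)
  then have "\<bar>a\<bar> = 1"
    using zmult_eq_1_iff by auto
  then have "normalized_volume (convex hull Y) = 1"
    using normalized_volume_simplex[OF finY cardY y0 f] ab unfolding A_def by simp
  moreover have "normalized_volume (convex hull Y) = normalized_volume (convex hull X)"
    unfolding Y_def convex_hull_linear_image[OF linear_relabel, symmetric]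
    using assms(1) by (intro normalized_volume_relabel finite_imp_compact_convex_hull)
  ultimately show ?thesis
    by simp
qed

text \<open>The affine hull contains the origin and the standard basis, so it is the whole space. A
  set of at most \<open>CARD('n) + 1\<close> points has that affine dimension only if no point is
  repeated and the points are affinely independent.\<close>

lemma affine_span_lattice_independent:
  fixes p :: "'i \<Rightarrow> real ^ 'n::finite"
  assumes "finite I" "card I = Suc CARD('n)" "lattice_points \<subseteq> affine hull (p ` I)"
  shows "inj_on p I" "\<not> affine_dependent (p ` I)"
proof -
  have "axis i 1 \<in> (lattice_points :: (real ^ 'n) set)" for i
    by (simp add: lattice_points_def axis_def)
  then have "Basis \<subseteq> affine hull (p ` I)"
    using assms(3) by (auto simp: Basis_vec_def)
  moreover have "0 \<in> affine hull (p ` I)"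
    using assms(3) by (auto simp: lattice_points_def)
  moreover have "subspace (affine hull (p ` I))"
    using \<open>0 \<in> affine hull (p ` I)\<close> by (simp add: subspace_affine affine_affine_hull)
  ultimately have "affine hull (p ` I) = UNIV"
    by (metis span_Basis span_minimal top.extremum_uniqueI)
  then have dim: "aff_dim (p ` I) = int CARD('n)"
    by (metis aff_dim_affine_hull aff_dim_UNIV DIM_cart DIM_real mult.right_neutral)
  have "card (p ` I) \<le> Suc CARD('n)"
    using card_image_le[OF assms(1)] assms(2) by metis
  moreover have "aff_dim (p ` I) \<le> int (card (p ` I)) - 1"
    using assms(1) by (intro aff_dim_le_card) simp
  ultimately have card: "card (p ` I) = Suc CARD('n)"
    using dim by linarith
  then show "inj_on p I"
    using assms(1,2) by (simp add: eq_card_imp_inj_on)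
  show "\<not> affine_dependent (p ` I)"
    using assms(1) card dim by (simp add: affine_independent_iff_card)
qed

text \<open>The vertices come as an indexed family, as for the cells below; that \<open>p\<close>
  repeats no vertex is derived from the generation property.\<close>

lemma unimodular_simplex:
  fixes p :: "'i \<Rightarrow> real ^ 'n::finite"
  assumes "finite I" "card I = Suc CARD('n)" "p ` I \<subseteq> lattice_points"
    and generates: "\<And>y. y \<in> lattice_points \<Longrightarrow>
      \<exists>c :: 'i \<Rightarrow> int. sum c I = 1 \<and> (\<Sum>i\<in>I. of_int (c i) *\<^sub>R p i) = y"
  shows "inj_on p I" "\<not> affine_dependent (p ` I)"
    "full_lattice_simplex (convex hull (p ` I))"
    "normalized_volume (convex hull (p ` I)) = 1"
proof -
  have "y \<in> affine hull (p ` I)" if y: "y \<in> lattice_points" for y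
  proof -
    obtain c :: "'i \<Rightarrow> int" where c: "sum c I = 1" "(\<Sum>i\<in>I. of_int (c i) *\<^sub>R p i) = y"
      using generates[OF y] by blast
    define w :: "_ \<Rightarrow> real" where "w x = (\<Sum>i | i \<in> I \<and> p i = x. of_int (c i))" for x
    have "sum w (p ` I) = (\<Sum>i\<in>I. of_int (c i))"
      using sum.image_gen[OF assms(1), of "\<lambda>i. real_of_int (c i)" p] by (simp add: w_def)
    moreover have "w x *\<^sub>R x = (\<Sum>i | i \<in> I \<and> p i = x. of_int (c i) *\<^sub>R p i)" for x
      by (auto simp: w_def scaleR_sum_left intro!: sum.cong)
    then have "(\<Sum>x\<in>p ` I. w x *\<^sub>R x) = (\<Sum>i\<in>I. of_int (c i) *\<^sub>R p i)"
      using sum.image_gen[OF assms(1), of "\<lambda>i. real_of_int (c i) *\<^sub>R p i" p] by simp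
    ultimately show ?thesis
      using assms(1) c by (auto simp: affine_hull_finite simp flip: of_int_sum intro!: exI[of _ w])
  qed
  then have sub: "lattice_points \<subseteq> affine hull (p ` I)"
    by blast
  show inj: "inj_on p I" and indep: "\<not> affine_dependent (p ` I)"
    using affine_span_lattice_independent[OF assms(1,2) sub] by blast+
  have card: "card (p ` I) = Suc CARD('n)"
    using assms(2) by (simp add: card_image inj)
  then show "full_lattice_simplex (convex hull (p ` I))"
    using indep assms(3)
    by (auto simp: full_lattice_simplex_def simplex_def extreme_point_of_convex_hull_affine_independent)
  show "normalized_volume (convex hull (p ` I)) = 1"
  proof (rule normalized_volume_unimodular)
    fix y :: "real ^ 'n"
    assume "y \<in> lattice_points"
    then obtain c :: "'i \<Rightarrow> int" where "sum c I = 1" "(\<Sum>i\<in>I. of_int (c i) *\<^sub>R p i) = y"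
      using generates by blast
    then have "sum (c \<circ> inv_into I p) (p ` I) = 1
        \<and> (\<Sum>x\<in>p ` I. of_int ((c \<circ> inv_into I p) x) *\<^sub>R x) = y"
      by (simp add: sum.reindex[OF inj] inj)
    then show "\<exists>c :: _ \<Rightarrow> int. sum c (p ` I) = 1 \<and> (\<Sum>x\<in>p ` I. of_int (c x) *\<^sub>R x) = y"
      by blast
  qed (use assms(1,3) card in auto)
qed

section \<open>Convex hulls of indexed families, triangulations and natural combinations\<close>

lemma convex_hull_image_finite:
  assumes "finite I"
  shows "convex hull (p ` I)
    = {\<Sum>i\<in>I. u i *\<^sub>R p i | u. (\<forall>i. 0 \<le> u i) \<and> (\<forall>i. i \<notin> I \<longrightarrow> u i = 0) \<and> sum u I = 1}"
    (is "_ = ?R")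
proof
  show "convex hull (p ` I) \<subseteq> ?R"
  proof
    fix y
    assume "y \<in> convex hull (p ` I)"
    then obtain w where w: "\<forall>x\<in>p ` I. 0 \<le> w x" "sum w (p ` I) = 1" "(\<Sum>x\<in>p ` I. w x *\<^sub>R x) = y"
      using assms by (auto simp: convex_hull_finite)
    \<comment> \<open>\<open>J\<close> holds one index for each point; it carries the whole weight
      of the point, and the remaining indices get 0.\<close>
    obtain J where J: "J \<subseteq> I" "inj_on p J" "p ` I = p ` J"
      using subset_image_inj[of "p ` I" p I] by auto
    define u where "u i = (if i \<in> J then w (p i) else 0)" for i
    have "sum u I = sum u J" "(\<Sum>i\<in>I. u i *\<^sub>R p i) = (\<Sum>i\<in>J. u i *\<^sub>R p i)"
      using J(1) assms by (intro sum.mono_neutral_right; simp add: u_def)+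
    moreover have "sum u J = 1" "(\<Sum>i\<in>J. u i *\<^sub>R p i) = y"
      using w(2,3) unfolding J(3) by (simp_all add: sum.reindex[OF J(2)] u_def)
    moreover have "\<forall>i. 0 \<le> u i" "\<forall>i. i \<notin> I \<longrightarrow> u i = 0"
      using w(1) J(1) by (auto simp: u_def)
    ultimately show "y \<in> ?R"
      by (intro CollectI exI[of _ u]) simp
  qed
  show "?R \<subseteq> convex hull (p ` I)"
  proof clarify
    fix u :: "_ \<Rightarrow> real"
    assume "\<forall>i. 0 \<le> u i" "sum u I = 1"
    then show "(\<Sum>i\<in>I. u i *\<^sub>R p i) \<in> convex hull (p ` I)"
      using assms by (intro convex_sum convex_convex_hull) (auto simp: hull_inc)
  qed
qed

text \<open>A point common to two hulls has the same coefficients in both, so they are supported on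
  \<open>A \<inter> B\<close>. Hence the hulls meet in the hull of the common vertices, which is a
  face by affine independence. Coefficients vanish off their index set so that they can be compared
  as functions.\<close>

lemma triangulation_from_unique_coefficients:
  fixes p :: "'i \<Rightarrow> 'a::euclidean_space"
  assumes "finite \<A>"
    and fin: "\<And>A. A \<in> \<A> \<Longrightarrow> finite A"
    and indep: "\<And>A. A \<in> \<A> \<Longrightarrow> \<not> affine_dependent (p ` A)"
    and unique: "\<And>A B u v. \<lbrakk>A \<in> \<A>; B \<in> \<A>; \<forall>i. 0 \<le> u i; \<forall>i. 0 \<le> v i;
        \<forall>i. i \<notin> A \<longrightarrow> u i = 0; \<forall>i. i \<notin> B \<longrightarrow> v i = 0; sum u A = 1; sum v B = 1;
        (\<Sum>i\<in>A. u i *\<^sub>R p i) = (\<Sum>i\<in>B. v i *\<^sub>R p i)\<rbrakk> \<Longrightarrow> u = (v :: 'i \<Rightarrow> real)"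
  shows "triangulation ((\<lambda>A. convex hull (p ` A)) ` \<A>)"
proof -
  have int: "convex hull (p ` A) \<inter> convex hull (p ` B) = convex hull (p ` (A \<inter> B))"
    if AB: "A \<in> \<A>" "B \<in> \<A>" for A B
  proof
    show "convex hull (p ` A) \<inter> convex hull (p ` B) \<subseteq> convex hull (p ` (A \<inter> B))"
    proof
      fix y
      assume y: "y \<in> convex hull (p ` A) \<inter> convex hull (p ` B)"
      from y obtain u where u: "\<forall>i. 0 \<le> u i" "\<forall>i. i \<notin> A \<longrightarrow> u i = 0" "sum u A = 1"
          "y = (\<Sum>i\<in>A. u i *\<^sub>R p i)"
        using AB fin by (auto simp: convex_hull_image_finite)
      from y obtain v where v: "\<forall>i. 0 \<le> v i" "\<forall>i. i \<notin> B \<longrightarrow> v i = 0" "sum v B = 1"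
          "y = (\<Sum>i\<in>B. v i *\<^sub>R p i)"
        using AB fin by (auto simp: convex_hull_image_finite)
      have "u = v"
        using u v by (intro unique[OF AB]) auto
      then have "\<forall>i\<in>A - (A \<inter> B). u i = 0"
        using v(2) by auto
      then have "sum u (A \<inter> B) = 1" "y = (\<Sum>i\<in>A \<inter> B. u i *\<^sub>R p i)"
        using sum.mono_neutral_right[of A "A \<inter> B" u] fin[OF AB(1)] u(3)
          sum.mono_neutral_right[of A "A \<inter> B" "\<lambda>i. u i *\<^sub>R p i"] u(4)
        by auto
      moreover from this(1) have "(\<Sum>i\<in>A \<inter> B. u i *\<^sub>R p i) \<in> convex hull (p ` (A \<inter> B))"
        using u(1) fin[OF AB(1)] by (intro convex_sum convex_convex_hull) (auto simp: hull_inc)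
      ultimately show "y \<in> convex hull (p ` (A \<inter> B))"
        by simp
    qed
  qed (intro Int_greatest hull_mono; blast)
  have face: "convex hull (p ` A) \<inter> convex hull (p ` B) face_of convex hull (p ` A)"
    if AB: "A \<in> \<A>" "B \<in> \<A>" for A B
    unfolding int[OF AB] face_of_convex_hull_affine_independent[OF indep[OF AB(1)]]
    by (intro exI[of _ "p ` (A \<inter> B)"]) auto
  have "\<exists>n. n simplex convex hull (p ` A)" if "A \<in> \<A>" for A
    using indep[OF that] by (auto simp: simplex_def intro!: exI[of _ "int (card (p ` A)) - 1"])
  then show ?thesis
    using assms(1) face by (auto simp: triangulation_def)
qed

text \<open>One copy of a point with positive multiplicity is split off at a time. This turns
  nonnegative integral coefficients with sum \<open>m\<close> into a sum of \<open>m\<close>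
  vertices.\<close>

lemma natural_combination_sum:
  fixes n :: "'i \<Rightarrow> nat" and p :: "'i \<Rightarrow> 'a::real_vector"
  assumes "finite A" "sum n A = m"
  shows "\<exists>q. (\<forall>i\<in>{1..m}. q i \<in> p ` A) \<and> (\<Sum>i\<in>A. real (n i) *\<^sub>R p i) = (\<Sum>i = 1..m. q i)"
  using assms(2)
proof (induction m arbitrary: n)
  case 0
  then show ?case
    using assms(1) by simp
next
  case (Suc m)
  then obtain k where k: "k \<in> A" "n k > 0"
    by (metis sum.neutral bot_nat_0.not_eq_extremum nat.distinct(1))
  define n' where "n' = n(k := n k - 1)"
  have rest: "sum n (A - {k}) = sum n' (A - {k})"
      "(\<Sum>i\<in>A - {k}. real (n i) *\<^sub>R p i) = (\<Sum>i\<in>A - {k}. real (n' i) *\<^sub>R p i)"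
    by (auto intro!: sum.cong simp: n'_def)
  have nk: "n k = Suc (n' k)"
    using k by (simp add: n'_def)
  have "sum n' A = m"
    using Suc.prems rest nk by (simp add: sum.remove[OF assms(1) k(1)])
  then obtain q where q: "\<forall>i\<in>{1..m}. q i \<in> p ` A" "(\<Sum>i\<in>A. real (n' i) *\<^sub>R p i) = (\<Sum>i = 1..m. q i)"
    using Suc.IH by blast
  have "(\<Sum>i\<in>A. real (n i) *\<^sub>R p i) = (\<Sum>i\<in>A. real (n' i) *\<^sub>R p i) + p k"
    using rest nk by (simp add: sum.remove[OF assms(1) k(1)] algebra_simps)
  also have "\<dots> = (\<Sum>i = 1..Suc m. (q(Suc m := p k)) i)"
    by (simp add: q(2))
  finally show ?case
    using q(1) k(1) by (intro exI[of _ "q(Suc m := p k)"]) auto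
qed

section \<open>Two-row Hermite normal form simplices\<close>

text \<open>Weights on \<open>h\<close> and \<open>h + 1\<close> with total \<kappa> have first
  moment between \<open>h * \<kappa>\<close> and \<open>(h + 1) * \<kappa>\<close>. For
  \<open>h < h'\<close> the two ranges can only touch at an end, which forces the outer weights to
  vanish.\<close>

lemma consecutive_coefficients_unique_aux:
  fixes \<alpha> \<beta> \<alpha>' \<beta>' :: real and h h' :: nat
  assumes "h < h'" "0 \<le> \<alpha>" "0 \<le> \<beta>" "0 \<le> \<alpha>'" "0 \<le> \<beta>'"
    and "\<alpha> + \<beta> = \<alpha>' + \<beta>'"
    and "real h * \<alpha> + (real h + 1) * \<beta> = real h' * \<alpha>' + (real h' + 1) * \<beta>'"
  shows "\<alpha> = 0 \<and> \<beta>' = 0 \<and> \<beta> = \<alpha>' \<and> (h' = Suc h \<or> \<beta> = 0)"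
proof -
  define \<kappa> where "\<kappa> = \<alpha> + \<beta>"
  have "real h * \<kappa> + \<beta> = real h' * (\<alpha>' + \<beta>') + \<beta>'"
    using assms(7) by (simp add: \<kappa>_def algebra_simps)
  \<comment> \<open>Three nonnegative terms add up to 0, so each of them is 0.\<close>
  then have eq: "(real h' - real h - 1) * \<kappa> + \<beta>' + \<alpha> = 0"
    unfolding assms(6)[symmetric] by (simp add: \<kappa>_def algebra_simps)
  have "0 \<le> (real h' - real h - 1) * \<kappa>"
    using assms(1-3) by (intro mult_nonneg_nonneg) (auto simp: \<kappa>_def)
  then have "\<beta>' = 0" "\<alpha> = 0" "(real h' - real h - 1) * \<kappa> = 0"
    using eq assms by linarith+
  then show ?thesis
    using assms(1,6) by (auto simp: \<kappa>_def)
qed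

text \<open>This is the case of a segment cut at its integer points: total weight and first moment
  determine the coefficients, also for a point shared by two unit intervals.\<close>

lemma consecutive_coefficients_unique:
  fixes u v :: "nat \<Rightarrow> real" and h h' :: nat
  assumes "\<And>k. 0 \<le> u k" "\<And>k. 0 \<le> v k"
    and "\<And>k. k \<noteq> h \<Longrightarrow> k \<noteq> Suc h \<Longrightarrow> u k = 0" "\<And>k. k \<noteq> h' \<Longrightarrow> k \<noteq> Suc h' \<Longrightarrow> v k = 0"
    and "u h + u (Suc h) = v h' + v (Suc h')"
    and "real h * u h + (real h + 1) * u (Suc h) = real h' * v h' + (real h' + 1) * v (Suc h')"
  shows "u = v"
proof -
  consider "h < h'" | "h' < h" | "h = h'" by linarith
  then have "u k = v k" for k
  proof cases
    case 1
    from consecutive_coefficients_unique_aux[OF 1 assms(1,1,2,2,5,6)] show ?thesis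
      using assms(3,4)[of k] 1
      by (cases "k = h"; cases "k = Suc h"; cases "k = h'"; cases "k = Suc h'") auto
  next
    case 2
    from consecutive_coefficients_unique_aux[OF 2 assms(2,2,1,1) assms(5,6)[symmetric]] show ?thesis
      using assms(3,4)[of k] 2
      by (cases "k = h"; cases "k = Suc h"; cases "k = h'"; cases "k = Suc h'") auto
  next
    case 3
    \<comment> \<open>The first moment is \<open>h\<close> times the total weight plus the weight at
      \<open>Suc h\<close>, so equal totals leave equal upper weights.\<close>
    have eq: "real h * (u h + u (Suc h)) + u (Suc h) = real h * (v h + v (Suc h)) + v (Suc h)"
      using assms(6) 3 by (simp add: algebra_simps)
    have sum: "u h + u (Suc h) = v h + v (Suc h)"
      using assms(5) 3 by simp
    have "u (Suc h) = v (Suc h)"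
      using eq unfolding sum by simp
    then show ?thesis
      using sum 3 assms(3,4)[of k] by (cases "k = h"; cases "k = Suc h") auto
  qed
  then show ?thesis
    by (rule ext)
qed

section \<open>Vertices, axis points and the coordinates of their combinations\<close>

locale hnf_simplex =
  fixes \<iota> :: "nat \<Rightarrow> 'n::finite" and d :: nat and M :: int and N :: nat
  assumes d_def: "d = CARD('n)"
    and numbering: "bij_betw \<iota> {1..d} UNIV"
    and d_ge: "2 \<le> d" and M_ge: "1 \<le> M" and N_ge: "2 \<le> N"
begin

text \<open>
  \<open>pt 0, \<dots>, pt (d - 1)\<close> are the vertices \<open>v\<^sub>0, \<dots>, v\<^bsub>d-1\<^esub>\<close>, while \<open>pt (d + h)\<close> is the
  point \<open>(1, \<dots>, 1, h)\<close> of the axis; in particular \<open>pt (d + N)\<close> is the vertex \<open>a\<close>.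
\<close>

definition coord :: "nat \<Rightarrow> nat \<Rightarrow> int" where
  "coord k j =
     (if k = 0 then 0
      else if k < d - 1 then (if j = k then 1 else 0)
      else if k = d - 1 then (if j = d then 0 else if j = d - 1 then M else M - 1)
      else if j = d then int k - int d else 1)"

definition pt :: "nat \<Rightarrow> real ^ 'n" where
  "pt k = int_vec \<iota> (coord k)"

definition simplex_set :: "(real ^ 'n) set" where
  "simplex_set = convex hull (pt ` insert (d + N) {..<d})"

lemma int_vec_nth: "j \<in> {1..d} \<Longrightarrow> int_vec \<iota> x $ \<iota> j = of_int (x j)"
proof -
  assume j: "j \<in> {1..d}"
  have "int_vec \<iota> x $ \<iota> j = (\<Sum>i = 1..d. real_of_int (x i) * axis (\<iota> i) 1 $ \<iota> j)"
    by (simp add: int_vec_def std_unit_def d_def)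
  also have "\<dots> = (\<Sum>i = 1..d. if i = j then real_of_int (x i) else 0)"
  proof (rule sum.cong)
    fix i
    assume "i \<in> {1..d}"
    then have "\<iota> i = \<iota> j \<longleftrightarrow> i = j"
      using j inj_on_eq_iff[OF bij_betw_imp_inj_on[OF numbering]] by blast
    then show "real_of_int (x i) * axis (\<iota> i) 1 $ \<iota> j = (if i = j then real_of_int (x i) else 0)"
      by (auto simp: axis_def)
  qed simp
  finally show ?thesis
    using j by simp
qed

lemma coordinates_cover: "(\<forall>i. P i) \<longleftrightarrow> (\<forall>j\<in>{1..d}. P (\<iota> j))"
proof
  assume *: "\<forall>j\<in>{1..d}. P (\<iota> j)"
  show "\<forall>i. P i"
  proof
    fix i
    have "i \<in> \<iota> ` {1..d}"
      using numbering by (simp add: bij_betw_def)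
    then show "P i"
      using * by blast
  qed
qed blast

lemma vec_eqI: "(\<And>j. j \<in> {1..d} \<Longrightarrow> x $ \<iota> j = y $ \<iota> j) \<Longrightarrow> x = y"
  using coordinates_cover[of "\<lambda>i. x $ i = y $ i"] by (simp add: vec_eq_iff)

lemma lattice_points_iff: "x \<in> lattice_points \<longleftrightarrow> (\<forall>j\<in>{1..d}. x $ \<iota> j \<in> \<int>)"
  using coordinates_cover[of "\<lambda>i. x $ i \<in> \<int>"] by (simp add: lattice_points_def)

lemma pt_nth: "j \<in> {1..d} \<Longrightarrow> pt k $ \<iota> j = of_int (coord k j)"
  by (simp add: pt_def int_vec_nth)

lemma pt_lattice: "pt k \<in> lattice_points"
  by (simp add: lattice_points_iff pt_nth)

lemma pt_axis_nth: "j \<in> {1..d} \<Longrightarrow> pt (d + h) $ \<iota> j = (if j = d then real h else 1)"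
proof -
  assume "j \<in> {1..d}"
  moreover have "d + h \<noteq> 0" "\<not> d + h < d - 1" "d + h \<noteq> d - 1"
    using d_ge by linarith+
  ultimately show ?thesis
    by (simp only: pt_nth coord_def if_False) auto
qed

lemma index_split: "{..<d} = insert 0 (insert (d - 1) {1..<d - 1})"
  using d_ge by auto

lemma sum_index_split:
  fixes f :: "nat \<Rightarrow> 'b::comm_monoid_add"
  shows "sum f {..<d} = f 0 + sum f {1..<d}"
proof -
  have "{..<d} = insert 0 {1..<d}"
    using d_ge by auto
  then show ?thesis by simp
qed

lemma base_combination_nth:
  fixes u :: "nat \<Rightarrow> real"
  assumes "j \<in> {1..d}"
  shows "(\<Sum>k<d. u k *\<^sub>R pt k) $ \<iota> j =
    (if j = d then 0 else if j = d - 1 then real_of_int M * u (d - 1) else u j + (real_of_int M - 1) * u (d - 1))"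
proof -
  have "(\<Sum>k<d. u k *\<^sub>R pt k) $ \<iota> j = (\<Sum>k<d. u k * of_int (coord k j))"
    using assms by (simp add: pt_nth)
  also have "\<dots> = u (d - 1) * of_int (coord (d - 1) j) + (\<Sum>k\<in>{1..<d - 1}. u k * of_int (coord k j))"
    unfolding index_split using d_ge by (simp add: coord_def)
  also have "(\<Sum>k\<in>{1..<d - 1}. u k * of_int (coord k j)) = (\<Sum>k\<in>{1..<d - 1}. if k = j then u k else 0)"
    using d_ge by (intro sum.cong) (auto simp: coord_def)
  also have "\<dots> = (if j \<in> {1..<d - 1} then u j else 0)"
    by simp
  finally show ?thesis
    using assms d_ge by (auto simp: coord_def)
qed

lemma full_combination_nth:
  fixes u :: "nat \<Rightarrow> real"
  assumes "j \<in> {1..d}"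
  shows "((\<Sum>k<d. u k *\<^sub>R pt k) + u (d + N) *\<^sub>R pt (d + N)) $ \<iota> j =
    (if j = d then real N * u (d + N) else
     if j = d - 1 then real_of_int M * u (d - 1) + u (d + N) else u j + (real_of_int M - 1) * u (d - 1) + u (d + N))"
  unfolding vector_add_component vector_scaleR_component base_combination_nth[OF assms]
    pt_axis_nth[OF assms] by auto

text \<open>Values of \<open>u\<close> off the index set do not enter, and no support condition is
  put on them; this lets witnesses be given by simple formulas.\<close>

lemma simplex_set_eq:
  "simplex_set = {(\<Sum>k<d. u k *\<^sub>R pt k) + u (d + N) *\<^sub>R pt (d + N) | u :: nat \<Rightarrow> real.
     (\<forall>k. 0 \<le> u k) \<and> (\<Sum>k<d. u k) + u (d + N) = 1}" (is "_ = ?R")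
proof -
  have sum: "sum f (insert (d + N) {..<d}) = sum f {..<d} + f (d + N)" for f :: "nat \<Rightarrow> 'b::comm_monoid_add"
    by (simp add: add.commute)
  have "simplex_set = {\<Sum>k\<in>insert (d + N) {..<d}. u k *\<^sub>R pt k | u.
      (\<forall>k. 0 \<le> u k) \<and> (\<forall>k. k \<notin> insert (d + N) {..<d} \<longrightarrow> u k = 0)
        \<and> sum u (insert (d + N) {..<d}) = 1}"
    unfolding simplex_set_def by (rule convex_hull_image_finite) simp
  then have "simplex_set \<subseteq> ?R"
    unfolding sum by blast
  moreover have "?R \<subseteq> simplex_set"
  proof clarify
    fix u :: "nat \<Rightarrow> real"
    assume u: "\<forall>k. 0 \<le> u k" "(\<Sum>k<d. u k) + u (d + N) = 1"
    have "(\<Sum>k\<in>insert (d + N) {..<d}. u k *\<^sub>R pt k) \<in> simplex_set"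
      unfolding simplex_set_def
    proof (rule convex_sum[OF _ convex_convex_hull])
      show "sum u (insert (d + N) {..<d}) = 1"
        using u(2) by (simp only: sum)
    qed (use u(1) in \<open>auto intro: hull_inc\<close>)
    then show "(\<Sum>k<d. u k *\<^sub>R pt k) + u (d + N) *\<^sub>R pt (d + N) \<in> simplex_set"
      by (simp only: sum)
  qed
  ultimately show ?thesis by blast
qed

text \<open>The coordinates form a triangular system: coordinate \<open>d\<close> gives the apex
  coefficient \<nu>, coordinate \<open>d - 1\<close> then gives the coefficient \<mu> of
  \<open>b\<close>, and the differences to coordinate \<open>d - 1\<close> give the others. The
  coefficients may be negative.\<close>

lemma full_combination_exists:
  obtains u :: "nat \<Rightarrow> real" where "(\<Sum>k<d. u k) + u (d + N) = t"
    "x = (\<Sum>k<d. u k *\<^sub>R pt k) + u (d + N) *\<^sub>R pt (d + N)"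
proof -
  define \<nu> where "\<nu> = x $ \<iota> d / real N"
  define \<mu> where "\<mu> = (x $ \<iota> (d - 1) - \<nu>) / real_of_int M"
  define g where "g k = (if k < d - 1 then x $ \<iota> k - x $ \<iota> (d - 1) + \<mu> else if k < d then \<mu> else \<nu>)"
    for k
  \<comment> \<open>Vertex 0 is the origin, so its coefficient is free to adjust the total to
    \<open>t\<close>.\<close>
  define u where "u = g(0 := t - \<nu> - (\<Sum>k\<in>{1..<d}. g k))"
  have "\<not> d + N < d - 1" "\<not> d + N < d" "d + N \<noteq> 0" "d - 1 \<noteq> 0" "d - 1 < d"
    using d_ge by linarith+
  then have u_last: "u (d - 1) = \<mu>" "u (d + N) = \<nu>"
    by (simp_all add: u_def g_def)
  have "(\<Sum>k\<in>{1..<d}. u k) = (\<Sum>k\<in>{1..<d}. g k)"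
    by (intro sum.cong) (auto simp: u_def)
  then have "(\<Sum>k<d. u k) + u (d + N) = t"
    using u_last by (simp add: sum_index_split) (simp add: u_def)
  moreover have "x = (\<Sum>k<d. u k *\<^sub>R pt k) + u (d + N) *\<^sub>R pt (d + N)"
  proof (rule vec_eqI)
    fix j
    assume j: "j \<in> {1..d}"
    have "real N * \<nu> = x $ \<iota> d" "real_of_int M * \<mu> = x $ \<iota> (d - 1) - \<nu>"
      using N_ge M_ge by (simp_all add: \<nu>_def \<mu>_def)
    moreover note u_last
    moreover have "u j = x $ \<iota> j - x $ \<iota> (d - 1) + \<mu>" if "j \<noteq> d" "j \<noteq> d - 1"
      using that j by (auto simp: u_def g_def)
    ultimately show "x $ \<iota> j = ((\<Sum>k<d. u k *\<^sub>R pt k) + u (d + N) *\<^sub>R pt (d + N)) $ \<iota> j"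
      unfolding full_combination_nth[OF j] by (auto simp: algebra_simps)
  qed
  ultimately show ?thesis
    using that by blast
qed

text \<open>The vertex \<open>v\<^sub>i\<close> and the apex are replaced by two consecutive points of the axis.\<close>

definition cell :: "nat \<Rightarrow> nat \<Rightarrow> nat set" where
  "cell i h = ({..<d} - {i}) \<union> {d + h, Suc (d + h)}"

lemma finite_cell: "finite (cell i h)"
  by (simp add: cell_def)

lemma card_cell: "i < d \<Longrightarrow> card (cell i h) = Suc CARD('n)"
  unfolding cell_def d_def[symmetric] by (subst card_Un_disjoint) auto

text \<open>The condition \<open>f i = 0\<close> fills the gap left by the removed vertex, so the
  formulas for sums over \<open>{..<d}\<close> apply to cells.\<close>

lemma sum_cell:
  fixes f :: "nat \<Rightarrow> 'b::ab_group_add"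
  assumes "i < d" "f i = 0"
  shows "sum f (cell i h) = sum f {..<d} + (f (d + h) + f (Suc (d + h)))"
proof -
  have "sum f (cell i h) = sum f ({..<d} - {i}) + sum f {d + h, Suc (d + h)}"
    unfolding cell_def by (subst sum.union_disjoint) auto
  then show ?thesis
    using assms by (simp add: sum_diff1)
qed

lemma cell_combination_nth:
  fixes u :: "nat \<Rightarrow> real"
  assumes "i < d" "u i = 0" "j \<in> {1..d}"
  shows "(\<Sum>k\<in>cell i h. u k *\<^sub>R pt k) $ \<iota> j =
    (if j = d then real h * u (d + h) + (real h + 1) * u (Suc (d + h)) else
     (if j = d - 1 then real_of_int M * u (d - 1) else u j + (real_of_int M - 1) * u (d - 1))
       + (u (d + h) + u (Suc (d + h))))"
proof -
  have "(\<Sum>k\<in>cell i h. u k *\<^sub>R pt k)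
      = (\<Sum>k<d. u k *\<^sub>R pt k) + (u (d + h) *\<^sub>R pt (d + h) + u (Suc (d + h)) *\<^sub>R pt (d + Suc h))"
    using assms by (subst sum_cell) auto
  then show ?thesis
    using pt_axis_nth[OF assms(3), of h] pt_axis_nth[OF assms(3), of "Suc h"]
      base_combination_nth[OF assms(3), of u]
    by (simp add: algebra_simps del: sum_component)
qed

lemma two_row_hnf_simplex_eq:
  "two_row_hnf_simplex \<iota> (\<lambda>i. if i = d then int N else 1)
     (\<lambda>i. if i = d then 0 else if i = d - 1 then M else M - 1) = simplex_set"
proof -
  have "std_unit \<iota> k = pt k" if "k \<in> {1..d - 2}" for k
  proof -
    have k: "k \<noteq> 0" "k < d - 1" "k \<in> {1..d}"
      using that d_ge by auto
    have "std_unit \<iota> k $ \<iota> j = (if j = k then 1 else 0)" if "j \<in> {1..d}" for j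
      using inj_on_eq_iff[OF bij_betw_imp_inj_on[OF numbering] that k(3)]
      by (auto simp: std_unit_def axis_def)
    then show ?thesis
      using k by (intro vec_eqI) (simp add: pt_nth coord_def)
  qed
  then have "std_unit \<iota> ` {1..d - 2} = pt ` {1..d - 2}"
    by (intro image_cong) auto
  moreover have "pt 0 = 0"
    by (rule vec_eqI) (simp add: pt_nth coord_def)
  moreover have "d - 1 \<noteq> 0"
    using d_ge by simp
  then have "coord (d - 1) = (\<lambda>i. if i = d then 0 else if i = d - 1 then M else M - 1)"
    by (intro ext) (simp only: coord_def if_False if_True less_irrefl refl)
  then have "int_vec \<iota> (\<lambda>i. if i = d then 0 else if i = d - 1 then M else M - 1) = pt (d - 1)"
    by (simp add: pt_def)
  moreover have "\<not> d + N < d - 1" "d + N \<noteq> 0" "d + N \<noteq> d - 1"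
    using d_ge by linarith+
  then have "coord (d + N) = (\<lambda>i. if i = d then int N else 1)"
    by (intro ext) (simp add: coord_def)
  then have "int_vec \<iota> (\<lambda>i. if i = d then int N else 1) = pt (d + N)"
    by (simp add: pt_def)
  moreover have "{..<d} = {0} \<union> {1..d - 2} \<union> {d - 1}"
    using d_ge by auto
  ultimately show ?thesis
    unfolding two_row_hnf_simplex_def simplex_set_def d_def[symmetric]
    by (simp only: image_insert image_Un image_empty) (simp add: insert_commute Un_commute)
qed

end

subsection \<open>Unimodular triangulation\<close>

locale balanced_hnf_simplex = hnf_simplex \<iota> d M N
  for \<iota> :: "nat \<Rightarrow> 'n::finite" and d :: nat and M :: int and N :: nat +
  assumes M_cases: "M = int d - 1 \<or> M = int d"
begin

text \<open>
  These are the \<open>M\<close> indices \<open>i\<close> for which \<open>(1, \<dots>, 1, 0)\<close> is the barycentre of the \<open>v\<^sub>i\<close>.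
\<close>

definition ring_idx :: "nat set" where
  "ring_idx = (if M = int d then {..<d} else {1..<d})"

lemma ring_idx_less: "i \<in> ring_idx \<Longrightarrow> i < d"
  by (auto simp: ring_idx_def split: if_splits)

lemma ring_idx_ge_1: "1 \<le> k \<Longrightarrow> k < d \<Longrightarrow> k \<in> ring_idx"
  by (simp add: ring_idx_def)

lemma last_in_ring_idx: "d - 1 \<in> ring_idx"
  using d_ge by (intro ring_idx_ge_1) auto

lemma not_in_ring_idx: "k < d \<Longrightarrow> k \<notin> ring_idx \<Longrightarrow> k = 0 \<and> M = int d - 1"
  using M_cases by (auto simp: ring_idx_def split: if_splits)

lemma finite_ring_idx: "finite ring_idx"
  by (simp add: ring_idx_def)

text \<open>\<open>ring_idx\<close> has exactly \<open>M\<close> elements in both cases.\<close>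

lemma sum_ring_idx: "(\<Sum>k<d. if k \<in> ring_idx then c else 0) = real_of_int M * c"
proof -
  have "(\<Sum>k<d. if k \<in> ring_idx then c else 0) = (\<Sum>k\<in>{..<d} \<inter> ring_idx. c)"
    by (rule sum.inter_restrict[symmetric]) simp
  also have "{..<d} \<inter> ring_idx = ring_idx"
    using ring_idx_less by auto
  also have "(\<Sum>k\<in>ring_idx. c) = real (card ring_idx) * c"
    by simp
  also have "real (card ring_idx) = real_of_int M"
    using M_cases d_ge by (auto simp: ring_idx_def of_nat_diff)
  finally show ?thesis .
qed

text \<open>
  Since \<open>(\<Sum>k\<in>ring_idx. v\<^sub>k) = M (1, \<dots>, 1, 0)\<close>, subtracting \<open>u i\<close> from all ring coefficients moves
  the weight \<open>M u i\<close> to the axis. The total axis weight is then split between the two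
  neighbouring axis points so as to keep the last coordinate \<open>N u (d + N)\<close>.
\<close>

definition axis_weight :: "nat \<Rightarrow> (nat \<Rightarrow> real) \<Rightarrow> real" where
  "axis_weight i u = real_of_int M * u i + u (d + N)"

definition cell_coeff :: "nat \<Rightarrow> nat \<Rightarrow> (nat \<Rightarrow> real) \<Rightarrow> nat \<Rightarrow> real" where
  "cell_coeff i h u k =
     (if k < d then u k - (if k \<in> ring_idx then u i else 0)
      else if k = d + h then (real h + 1) * axis_weight i u - real N * u (d + N)
      else if k = Suc (d + h) then real N * u (d + N) - real h * axis_weight i u
      else 0)"

section \<open>Total, integrality and sign of the cell coefficients\<close>

lemma cell_coeff_axis:
  "cell_coeff i h u (d + h) = (real h + 1) * axis_weight i u - real N * u (d + N)"
  "cell_coeff i h u (Suc (d + h)) = real N * u (d + N) - real h * axis_weight i u"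
  by (simp_all add: cell_coeff_def)

lemma cell_coeff_ring: "k \<in> ring_idx \<Longrightarrow> cell_coeff i h u k = u k - u i"
  by (simp add: cell_coeff_def ring_idx_less)

lemma sum_cell_coeff:
  assumes "i \<in> ring_idx"
  shows "sum (cell_coeff i h u) (cell i h) = (\<Sum>k<d. u k) + u (d + N)"
proof -
  have "sum (cell_coeff i h u) (cell i h) = sum (cell_coeff i h u) {..<d} + axis_weight i u"
    using assms by (subst sum_cell) (simp_all add: ring_idx_less cell_coeff_ring cell_coeff_axis algebra_simps)
  also have "sum (cell_coeff i h u) {..<d} = (\<Sum>k<d. u k - (if k \<in> ring_idx then u i else 0))"
    by (rule sum.cong) (simp_all add: cell_coeff_def)
  also have "\<dots> = (\<Sum>k<d. u k) - real_of_int M * u i"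
    unfolding sum_subtractf sum_ring_idx ..
  finally show ?thesis
    by (simp add: axis_weight_def)
qed

lemma cell_coeff_combination:
  assumes "i \<in> ring_idx"
  shows "(\<Sum>k\<in>cell i h. cell_coeff i h u k *\<^sub>R pt k)
    = (\<Sum>k<d. u k *\<^sub>R pt k) + u (d + N) *\<^sub>R pt (d + N)"
proof (rule vec_eqI)
  fix j
  assume j: "j \<in> {1..d}"
  have i: "i < d" "cell_coeff i h u i = 0"
    using assms by (simp_all add: ring_idx_less cell_coeff_ring)
  have axis: "cell_coeff i h u (d + h) + cell_coeff i h u (Suc (d + h)) = axis_weight i u"
    "real h * cell_coeff i h u (d + h) + (real h + 1) * cell_coeff i h u (Suc (d + h))
      = real N * u (d + N)"
    by (simp_all add: cell_coeff_axis algebra_simps)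
  have "cell_coeff i h u j = u j - u i" if "j \<noteq> d"
    using that j by (intro cell_coeff_ring ring_idx_ge_1) auto
  then show "(\<Sum>k\<in>cell i h. cell_coeff i h u k *\<^sub>R pt k) $ \<iota> j
      = ((\<Sum>k<d. u k *\<^sub>R pt k) + u (d + N) *\<^sub>R pt (d + N)) $ \<iota> j"
    unfolding cell_combination_nth[where u = "cell_coeff i h u", OF i j] full_combination_nth[OF j] axis
      cell_coeff_ring[OF last_in_ring_idx]
    by (simp add: axis_weight_def algebra_simps)
qed

text \<open>Integral coordinates make \<open>N * u (d + N)\<close>,
  \<open>M * u (d - 1) + u (d + N)\<close> and the differences \<open>u k - u (d - 1)\<close>
  integral, and the cell coefficients are built from these. The total is only required to be an
  integer, so that points of dilates are covered.\<close>

lemma cell_coeff_Ints: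
  assumes "i \<in> ring_idx" "x \<in> lattice_points" "(\<Sum>k<d. u k) + u (d + N) \<in> \<int>"
    and x: "x = (\<Sum>k<d. u k *\<^sub>R pt k) + u (d + N) *\<^sub>R pt (d + N)"
  shows "cell_coeff i h u k \<in> \<int>"
proof -
  have x_int: "x $ \<iota> j \<in> \<int>" if "j \<in> {1..d}" for j
    using assms(2) that by (simp add: lattice_points_iff)
  have d: "d \<in> {1..d}" "d - 1 \<in> {1..d}" "d - 1 \<noteq> d"
    using d_ge by auto
  have last: "real_of_int M * u (d - 1) + u (d + N) \<in> \<int>"
    using x_int[OF d(2)] d(3) unfolding x full_combination_nth[OF d(2)] by simp
  have height: "real N * u (d + N) \<in> \<int>"
    using x_int[OF d(1)] unfolding x full_combination_nth[OF d(1)] by simp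
  have diff: "u k - u (d - 1) \<in> \<int>" if "1 \<le> k" "k < d" for k
  proof (cases "k = d - 1")
    case False
    have "x $ \<iota> k - (real_of_int M * u (d - 1) + u (d + N)) \<in> \<int>"
      using that by (intro Ints_diff x_int last) auto
    moreover have "x $ \<iota> k = u k + (real_of_int M - 1) * u (d - 1) + u (d + N)"
      using full_combination_nth[of k u] that False unfolding x by auto
    ultimately show ?thesis
      by (simp add: algebra_simps)
  qed simp
  have "(\<Sum>k\<in>{1..<d}. u k - u (d - 1)) \<in> \<int>"
    using diff by (intro Ints_sum) auto
  \<comment> \<open>Index 0 is controlled by the total alone. What remains has the factor
    \<open>d - 1 - M\<close>, which is 0 or -1: either \<open>u 0\<close> itself is integral, or 0
    is a ring index and \<open>u 0 - u (d - 1)\<close> is.\<close>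
  then have "((\<Sum>k<d. u k) + u (d + N)) - (\<Sum>k\<in>{1..<d}. u k - u (d - 1))
      - (real_of_int M * u (d - 1) + u (d + N)) \<in> \<int>"
    using assms(3) last by (intro Ints_diff)
  also have "((\<Sum>k<d. u k) + u (d + N)) - (\<Sum>k\<in>{1..<d}. u k - u (d - 1))
      - (real_of_int M * u (d - 1) + u (d + N)) = u 0 + (real d - 1 - real_of_int M) * u (d - 1)"
    using d_ge by (simp add: sum_index_split[of u] sum_subtractf of_nat_diff algebra_simps)
  finally have zero: "u 0 + (real d - 1 - real_of_int M) * u (d - 1) \<in> \<int>" .
  have ring: "u k - u (d - 1) \<in> \<int>" if "k \<in> ring_idx" for k
  proof (cases "k = 0")
    case True
    then have "M = int d"
      using that by (simp add: ring_idx_def split: if_splits)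
    then show ?thesis
      using zero True by simp
  qed (use diff ring_idx_less[OF that] in auto)
  have ring': "u k - u i \<in> \<int>" if "k \<in> ring_idx" for k
    using Ints_diff[OF ring[OF that] ring[OF assms(1)]] by simp
  have "real_of_int M * (u i - u (d - 1)) + (real_of_int M * u (d - 1) + u (d + N)) \<in> \<int>"
    by (rule Ints_add[OF Ints_mult[OF Ints_of_int ring[OF assms(1)]] last])
  then have weight: "axis_weight i u \<in> \<int>"
    by (simp add: axis_weight_def algebra_simps)
  consider "k \<in> ring_idx" | "k < d" "k \<notin> ring_idx" | "k = d + h" | "k = Suc (d + h)"
    | "d \<le> k" "k \<noteq> d + h" "k \<noteq> Suc (d + h)"
    by linarith
  then show ?thesis
  proof cases
    case 1
    then show ?thesis
      using ring' by (simp add: cell_coeff_ring)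
  next
    case 2
    have "k = 0" "M = int d - 1"
      using 2 not_in_ring_idx by blast+
    have "cell_coeff i h u k = u 0"
      using 2 \<open>k = 0\<close> by (simp add: cell_coeff_def)
    then show ?thesis
      using zero unfolding \<open>M = int d - 1\<close> by simp
  next
    case 3
    have "(real h + 1) * axis_weight i u - real N * u (d + N) \<in> \<int>"
      by (intro Ints_diff height Ints_mult[OF _ weight]) auto
    then show ?thesis
      by (simp add: 3 cell_coeff_axis)
  next
    case 4
    have "real N * u (d + N) - real h * axis_weight i u \<in> \<int>"
      by (intro Ints_diff height Ints_mult[OF _ weight]) auto
    then show ?thesis
      by (simp add: 4 cell_coeff_axis)
  qed (simp add: cell_coeff_def)
qed

text \<open>Any lattice point has real affine coordinates in the vertices of the simplex, and
  \<open>cell_coeff\<close> turns them into integral ones in the vertices of the cell.\<close>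

lemma cell_unimodular:
  assumes i: "i \<in> ring_idx"
  shows "\<not> affine_dependent (pt ` cell i h)" "full_lattice_simplex (convex hull (pt ` cell i h))"
    "normalized_volume (convex hull (pt ` cell i h)) = 1"
proof -
  have "\<exists>c :: nat \<Rightarrow> int. sum c (cell i h) = 1 \<and> (\<Sum>k\<in>cell i h. of_int (c k) *\<^sub>R pt k) = y"
    if y: "y \<in> lattice_points" for y
  proof -
    obtain u :: "nat \<Rightarrow> real" where u: "(\<Sum>k<d. u k) + u (d + N) = 1"
      "y = (\<Sum>k<d. u k *\<^sub>R pt k) + u (d + N) *\<^sub>R pt (d + N)"
      by (rule full_combination_exists)
    have "\<forall>k. cell_coeff i h u k \<in> \<int>"
      using cell_coeff_Ints[OF i y _ u(2)] u(1) by simp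
    then have c: "of_int \<lfloor>cell_coeff i h u k\<rfloor> = cell_coeff i h u k" for k
      by simp
    have "real_of_int (\<Sum>k\<in>cell i h. \<lfloor>cell_coeff i h u k\<rfloor>) = 1"
      unfolding of_int_sum c sum_cell_coeff[OF i] u(1) ..
    then have "(\<Sum>k\<in>cell i h. \<lfloor>cell_coeff i h u k\<rfloor>) = 1"
      by linarith
    moreover have "(\<Sum>k\<in>cell i h. of_int \<lfloor>cell_coeff i h u k\<rfloor> *\<^sub>R pt k) = y"
      unfolding c cell_coeff_combination[OF i] u(2) ..
    ultimately show ?thesis by blast
  qed
  note uni = unimodular_simplex[OF finite_cell card_cell[OF ring_idx_less[OF i]] _ this]
  show "\<not> affine_dependent (pt ` cell i h)" "full_lattice_simplex (convex hull (pt ` cell i h))"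
    "normalized_volume (convex hull (pt ` cell i h)) = 1"
    using pt_lattice by (intro uni; blast)+
qed

text \<open>Choosing \<open>i\<close> with the least ring coefficient keeps the ring coefficients
  nonnegative. Choosing \<open>h\<close> with the height \<open>y / \<kappa>\<close> between
  \<open>h\<close> and \<open>h + 1\<close> keeps the two axis coefficients nonnegative.\<close>

lemma nonneg_cell_coeff_exists:
  assumes "\<forall>k. 0 \<le> u k"
  shows "\<exists>i\<in>ring_idx. \<exists>h<N. \<forall>k. 0 \<le> cell_coeff i h u k"
proof -
  obtain i where i: "i \<in> ring_idx" "\<forall>k\<in>ring_idx. u i \<le> u k"
    using finite_ring_idx last_in_ring_idx arg_min_if_finite(1)[of ring_idx u]
      arg_min_least[of ring_idx _ u] by (metis empty_iff)
  define \<kappa> where "\<kappa> = axis_weight i u"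
  define y where "y = real N * u (d + N)"
  have "0 \<le> real_of_int M * u i"
    using M_ge assms by simp
  then have \<kappa>: "0 \<le> \<kappa>" "y \<le> real N * \<kappa>" "0 \<le> y"
    using assms by (auto simp: \<kappa>_def y_def axis_weight_def intro!: mult_left_mono)
  have "\<exists>h<N. real h * \<kappa> \<le> y \<and> y \<le> (real h + 1) * \<kappa>"
  \<comment> \<open>At the top of the axis the floor would give \<open>N\<close>, so the last
    interval is taken; this case also covers \<kappa> = 0.\<close>
  proof (cases "y = real N * \<kappa>")
    case True
    then show ?thesis
      using N_ge \<kappa>(1) by (intro exI[of _ "N - 1"]) (auto simp: of_nat_diff algebra_simps)
  next
    case False
    then have "\<kappa> > 0"
      using \<kappa> by (cases "\<kappa> = 0") auto
    define h where "h = nat \<lfloor>y / \<kappa>\<rfloor>"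
    have "0 \<le> y / \<kappa>"
      using \<kappa> by simp
    then have h: "real h \<le> y / \<kappa>" "y / \<kappa> < real h + 1"
      unfolding h_def by linarith+
    have "y / \<kappa> < real N"
      using False \<kappa> \<open>\<kappa> > 0\<close> by (simp add: divide_less_eq)
    then have "h < N"
      using h by linarith
    moreover have "real h * \<kappa> \<le> y" "y \<le> (real h + 1) * \<kappa>"
      using h \<open>\<kappa> > 0\<close> by (simp_all add: le_divide_eq divide_less_eq)
    ultimately show ?thesis by blast
  qed
  then obtain h where h: "h < N" "real h * \<kappa> \<le> y" "y \<le> (real h + 1) * \<kappa>"
    by blast
  have "0 \<le> cell_coeff i h u k" for k
    using h(2,3) i(2) assms by (auto simp: cell_coeff_def \<kappa>_def[symmetric] y_def[symmetric])
  then show ?thesis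
    using i(1) h(1) by blast
qed

text \<open>Comparing coordinates shows that \<open>u\<close> and \<open>v\<close> differ by one
  constant \<delta> on all ring indices. Each has a zero there and is nonnegative, so \<delta> is 0
  and only the axis coefficients remain to be compared.\<close>

lemma cell_coefficients_unique:
  fixes u v :: "nat \<Rightarrow> real"
  assumes i: "i \<in> ring_idx" "i' \<in> ring_idx"
    and nonneg: "\<forall>k. 0 \<le> u k" "\<forall>k. 0 \<le> v k"
    and supp: "\<forall>k. k \<notin> cell i h \<longrightarrow> u k = 0" "\<forall>k. k \<notin> cell i' h' \<longrightarrow> v k = 0"
    and total: "sum u (cell i h) = 1" "sum v (cell i' h') = 1"
    and same: "(\<Sum>k\<in>cell i h. u k *\<^sub>R pt k) = (\<Sum>k\<in>cell i' h'. v k *\<^sub>R pt k)"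
  shows "u = v"
proof -
  have id: "i < d" "i' < d"
    using i ring_idx_less by auto
  have zero: "u i = 0" "v i' = 0"
    using supp id by (auto simp: cell_def)
  define \<kappa> where "\<kappa> = u (d + h) + u (Suc (d + h))"
  define \<kappa>' where "\<kappa>' = v (d + h') + v (Suc (d + h'))"
  define \<delta> where "\<delta> = u (d - 1) - v (d - 1)"
  have nth: "(if j = d then real h * u (d + h) + (real h + 1) * u (Suc (d + h)) else
     (if j = d - 1 then real_of_int M * u (d - 1) else u j + (real_of_int M - 1) * u (d - 1)) + \<kappa>)
    = (if j = d then real h' * v (d + h') + (real h' + 1) * v (Suc (d + h')) else
     (if j = d - 1 then real_of_int M * v (d - 1) else v j + (real_of_int M - 1) * v (d - 1)) + \<kappa>')"
    if "j \<in> {1..d}" for j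
    using cell_combination_nth[of i u j h, OF id(1) zero(1) that]
      cell_combination_nth[of i' v j h', OF id(2) zero(2) that]
    unfolding same \<kappa>_def \<kappa>'_def by (rule trans[OF sym])
  have d: "d \<in> {1..d}" "d - 1 \<in> {1..d}" "d - 1 \<noteq> d"
    using d_ge by auto
  have last: "real_of_int M * u (d - 1) + \<kappa> = real_of_int M * v (d - 1) + \<kappa>'"
    using nth[OF d(2)] d(3) by simp
  have height: "real h * u (d + h) + (real h + 1) * u (Suc (d + h))
      = real h' * v (d + h') + (real h' + 1) * v (Suc (d + h'))"
    using nth[OF d(1)] by simp
  have M\<delta>: "real_of_int M * \<delta> + \<kappa> - \<kappa>' = 0"
    using last by (simp add: \<delta>_def algebra_simps)
  have base: "u k - v k = \<delta>" if "1 \<le> k" "k < d" for k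
  proof (cases "k = d - 1")
    case False
    have "u k + (real_of_int M - 1) * u (d - 1) + \<kappa> = v k + (real_of_int M - 1) * v (d - 1) + \<kappa>'"
      using nth[of k] that False by simp
    then show ?thesis
      using last by (simp add: \<delta>_def algebra_simps)
  qed (simp add: \<delta>_def)
  have "(\<Sum>k\<in>{1..<d}. u k) - (\<Sum>k\<in>{1..<d}. v k) = (\<Sum>k\<in>{1..<d}. \<delta>)"
    unfolding sum_subtractf[symmetric] using base by (intro sum.cong) auto
  also have "\<dots> = (real d - 1) * \<delta>"
    using d_ge by (simp add: of_nat_diff)
  finally have rest: "(\<Sum>k\<in>{1..<d}. u k) - (\<Sum>k\<in>{1..<d}. v k) = (real d - 1) * \<delta>" .
  have "(\<Sum>k<d. u k) + \<kappa> = (\<Sum>k<d. v k) + \<kappa>'"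
    using total sum_cell[OF id(1), of u h] sum_cell[OF id(2), of v h'] zero
    by (simp add: \<kappa>_def \<kappa>'_def)
  \<comment> \<open>The factor is 0 for \<open>M = d - 1\<close> and 1 for \<open>M = d\<close>, in
    step with whether 0 is a ring index.\<close>
  then have "u 0 - v 0 = (real_of_int M - (real d - 1)) * \<delta>"
    using rest M\<delta> by (simp add: sum_index_split[of u] sum_index_split[of v] algebra_simps)
  then have zeroth: "u 0 - v 0 = (if M = int d then \<delta> else 0)"
    using M_cases by (elim disjE) simp_all
  have ring: "u k - v k = \<delta>" if "k \<in> ring_idx" for k
  proof (cases "k = 0")
    case True
    then have "M = int d"
      using that by (simp add: ring_idx_def split: if_splits)
    then show ?thesis
      using zeroth True by simp
  qed (use base ring_idx_less[OF that] in auto)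
  \<comment> \<open>At \<open>i\<close> the difference is \<open>- v i\<close>, at \<open>i'\<close>
    it is \<open>u i'\<close>, so \<delta> is both at most and at least 0.\<close>
  have "0 \<le> u i'" "0 \<le> v i"
    using nonneg by auto
  then have "\<delta> = 0"
    using ring[OF i(1)] ring[OF i(2)] zero by linarith
  then have low: "u k = v k" if "k < d" for k
    using base[of k] zeroth that by (cases "k = 0") auto
  have "\<kappa> = \<kappa>'"
    using M\<delta> \<open>\<delta> = 0\<close> by simp
  have "(\<lambda>k. u (d + k)) = (\<lambda>k. v (d + k))"
  proof (rule consecutive_coefficients_unique)
    show "u (d + k) = 0" if "k \<noteq> h" "k \<noteq> Suc h" for k
      using supp(1) that by (auto simp: cell_def)
    show "v (d + k) = 0" if "k \<noteq> h'" "k \<noteq> Suc h'" for k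
      using supp(2) that by (auto simp: cell_def)
  qed (use nonneg \<open>\<kappa> = \<kappa>'\<close> height in \<open>simp_all add: \<kappa>_def \<kappa>'_def\<close>)
  then have "u k = v k" if "d \<le> k" for k
    using fun_cong[of _ _ "k - d"] that by (metis le_add_diff_inverse)
  with low show ?thesis
    by (metis ext not_le)
qed

section \<open>Axis points, the triangulation and integer decomposition\<close>

lemma axis_point_in_simplex:
  assumes "h \<le> N"
  shows "pt (d + h) \<in> simplex_set"
proof -
  define t where "t = real h / real N"
  have t: "0 \<le> t" "t \<le> 1" "real N * t = real h"
    using assms N_ge by (auto simp: t_def)
  \<comment> \<open>The axis point divides the segment from the barycentre of the ring vertices to
    the apex in the ratio given by \<open>t\<close>; the weight \<open>1 - t\<close> is spread
    evenly over the \<open>M\<close> ring vertices.\<close>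
  define u where "u k = (if k < d then (if k \<in> ring_idx then (1 - t) / real_of_int M else 0)
      else if k = d + N then t else 0)" for k
  have M: "real_of_int M * ((1 - t) / real_of_int M) = 1 - t"
    using M_ge by simp
  have "(\<Sum>k<d. u k) = (\<Sum>k<d. if k \<in> ring_idx then (1 - t) / real_of_int M else 0)"
    by (intro sum.cong) (auto simp: u_def)
  then have "(\<Sum>k<d. u k) = 1 - t"
    unfolding sum_ring_idx M .
  moreover have u_top: "u (d + N) = t"
    by (simp add: u_def)
  moreover have "\<forall>k. 0 \<le> u k"
    using t M_ge by (auto simp: u_def)
  moreover have "pt (d + h) = (\<Sum>k<d. u k *\<^sub>R pt k) + u (d + N) *\<^sub>R pt (d + N)"
  proof (rule vec_eqI)
    fix j
    assume j: "j \<in> {1..d}"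
    have u_ring: "u k = (1 - t) / real_of_int M" if "1 \<le> k" "k < d" for k
      using that by (simp add: u_def ring_idx_ge_1)
    have "u (d - 1) = (1 - t) / real_of_int M"
      using d_ge by (intro u_ring) auto
    moreover have "u j = (1 - t) / real_of_int M" if "j \<noteq> d"
      using that j by (intro u_ring) auto
    ultimately show "pt (d + h) $ \<iota> j = ((\<Sum>k<d. u k *\<^sub>R pt k) + u (d + N) *\<^sub>R pt (d + N)) $ \<iota> j"
      unfolding full_combination_nth[OF j] pt_axis_nth[OF j] unfolding u_top
      using t M M_ge by (auto simp: left_diff_distrib simp del: times_divide_eq_right)
  qed
  ultimately show ?thesis
    unfolding simplex_set_eq by (intro CollectI exI[of _ u]) auto
qed

lemma cell_points_in_simplex:
  assumes "h < N"
  shows "pt ` cell i h \<subseteq> simplex_set"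
proof -
  have "pt k \<in> simplex_set" if "k < d" for k
    using that unfolding simplex_set_def by (intro hull_inc) auto
  then show ?thesis
    using assms axis_point_in_simplex[of h] axis_point_in_simplex[of "Suc h"]
    by (auto simp: cell_def)
qed

lemma unimodular_triangulation_exists: "\<exists>\<T>. unimodular_triangulation \<T> simplex_set"
proof -
  define \<A> where "\<A> = (\<lambda>(i, h). cell i h) ` (ring_idx \<times> {..<N})"
  define \<T> where "\<T> = (\<lambda>A. convex hull (pt ` A)) ` \<A>"
  have "triangulation \<T>"
    unfolding \<T>_def
  proof (rule triangulation_from_unique_coefficients)
    show "finite \<A>"
      by (simp add: \<A>_def finite_ring_idx)
    show "finite A" if "A \<in> \<A>" for A
      using that by (auto simp: \<A>_def finite_cell)
    show "\<not> affine_dependent (pt ` A)" if "A \<in> \<A>" for A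
      using that cell_unimodular(1) by (auto simp: \<A>_def)
    fix A B and u v :: "nat \<Rightarrow> real"
    assume "A \<in> \<A>" "B \<in> \<A>"
    then obtain i h i' h' where "A = cell i h" "B = cell i' h'" "i \<in> ring_idx" "i' \<in> ring_idx"
      by (auto simp: \<A>_def)
    moreover assume "\<forall>k. 0 \<le> u k" "\<forall>k. 0 \<le> v k" "\<forall>k. k \<notin> A \<longrightarrow> u k = 0"
      "\<forall>k. k \<notin> B \<longrightarrow> v k = 0" "sum u A = 1" "sum v B = 1"
      "(\<Sum>k\<in>A. u k *\<^sub>R pt k) = (\<Sum>k\<in>B. v k *\<^sub>R pt k)"
    ultimately show "u = v"
      by (intro cell_coefficients_unique[of i i' u v h h']) simp_all
  qed
  moreover have "\<Union>\<T> = simplex_set"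
  proof
    have "convex hull (pt ` cell i h) \<subseteq> simplex_set" if "h < N" for i h
      using cell_points_in_simplex[OF that] hull_minimal convex_convex_hull simplex_set_def by metis
    then show "\<Union>\<T> \<subseteq> simplex_set"
      by (auto simp: \<T>_def \<A>_def)
    show "simplex_set \<subseteq> \<Union>\<T>"
    proof
      fix x
      assume "x \<in> simplex_set"
      then obtain u where u: "\<forall>k. 0 \<le> u k" "(\<Sum>k<d. u k) + u (d + N) = 1"
        "x = (\<Sum>k<d. u k *\<^sub>R pt k) + u (d + N) *\<^sub>R pt (d + N)"
        unfolding simplex_set_eq by blast
      obtain i h where ih: "i \<in> ring_idx" "h < N" "\<forall>k. 0 \<le> cell_coeff i h u k"
        using nonneg_cell_coeff_exists[OF u(1)] by blast
      have "(\<Sum>k\<in>cell i h. cell_coeff i h u k *\<^sub>R pt k) \<in> convex hull (pt ` cell i h)"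
        using ih sum_cell_coeff[OF ih(1), of h u] u(2)
        by (intro convex_sum convex_convex_hull finite_cell) (simp_all add: hull_inc)
      then have "x \<in> convex hull (pt ` cell i h)"
        unfolding cell_coeff_combination[OF ih(1)] u(3) .
      moreover have "cell i h \<in> \<A>"
        using ih by (auto simp: \<A>_def)
      ultimately show "x \<in> \<Union>\<T>"
        by (auto simp: \<T>_def)
    qed
  qed
  moreover have "\<forall>T\<in>\<T>. full_lattice_simplex T \<and> normalized_volume T = 1"
    using cell_unimodular by (auto simp: \<T>_def \<A>_def)
  ultimately show ?thesis
    by (auto simp: unimodular_triangulation_def lattice_triangulation_def)
qed

text \<open>The scaled coefficients of \<open>p\<close> have total \<open>m\<close>, and in a
  suitable cell they become nonnegative integers with the same total. So \<open>p\<close> is a sum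
  of \<open>m\<close> vertices of a single cell.\<close>

lemma integer_decomposition: "integer_decomposition_property simplex_set"
  unfolding integer_decomposition_property_def
proof (intro allI impI ballI)
  fix m :: nat and p :: "real ^ 'n"
  assume "1 \<le> m" and p: "p \<in> (\<lambda>x. real m *\<^sub>R x) ` simplex_set \<inter> lattice_points"
  then obtain x where x: "x \<in> simplex_set" "p = real m *\<^sub>R x" "p \<in> lattice_points"
    by blast
  then obtain w where w: "\<forall>k. 0 \<le> w k" "(\<Sum>k<d. w k) + w (d + N) = 1"
    "x = (\<Sum>k<d. w k *\<^sub>R pt k) + w (d + N) *\<^sub>R pt (d + N)"
    unfolding simplex_set_eq by blast
  define u where "u k = real m * w k" for k
  have u: "\<forall>k. 0 \<le> u k" "(\<Sum>k<d. u k) + u (d + N) = real m"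
    "p = (\<Sum>k<d. u k *\<^sub>R pt k) + u (d + N) *\<^sub>R pt (d + N)"
  proof -
    have "(\<Sum>k<d. u k) + u (d + N) = real m * ((\<Sum>k<d. w k) + w (d + N))"
      by (simp add: u_def sum_distrib_left distrib_left)
    then show "(\<Sum>k<d. u k) + u (d + N) = real m"
      using w(2) by simp
    show "p = (\<Sum>k<d. u k *\<^sub>R pt k) + u (d + N) *\<^sub>R pt (d + N)"
      unfolding x(2) w(3) by (simp add: u_def scaleR_sum_right scaleR_add_right)
  qed (simp add: u_def w(1))
  obtain i h where ih: "i \<in> ring_idx" "h < N" "\<forall>k. 0 \<le> cell_coeff i h u k"
    using nonneg_cell_coeff_exists[OF u(1)] by blast
  define n where "n k = nat \<lfloor>cell_coeff i h u k\<rfloor>" for k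
  have "cell_coeff i h u k \<in> \<int>" for k
    using cell_coeff_Ints[OF ih(1) x(3) _ u(3)] u(2) by simp
  then have n: "real (n k) = cell_coeff i h u k" for k
    using ih(3) by (simp add: n_def)
  have "real (sum n (cell i h)) = real m"
    unfolding of_nat_sum n sum_cell_coeff[OF ih(1)] u(2) ..
  then have "sum n (cell i h) = m"
    by (simp only: of_nat_eq_iff)
  from natural_combination_sum[OF finite_cell this, of pt] obtain q where
    q: "\<forall>l\<in>{1..m}. q l \<in> pt ` cell i h" "(\<Sum>k\<in>cell i h. real (n k) *\<^sub>R pt k) = (\<Sum>l = 1..m. q l)"
    by blast
  have "p = (\<Sum>l = 1..m. q l)"
    unfolding q(2)[symmetric] n cell_coeff_combination[OF ih(1)] u(3) ..
  moreover have "pt ` cell i h \<subseteq> simplex_set \<inter> lattice_points"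
    using cell_points_in_simplex[OF ih(2), of i] pt_lattice by auto
  then have "\<forall>l\<in>{1..m}. q l \<in> simplex_set \<inter> lattice_points"
    using q(1) by blast
  ultimately show "\<exists>q. (\<forall>l\<in>{1..m}. q l \<in> simplex_set \<inter> lattice_points) \<and> p = (\<Sum>l = 1..m. q l)"
    by blast
qed

end

subsection \<open>Simplices without further lattice points\<close>

locale sparse_hnf_simplex = hnf_simplex \<iota> d M N
  for \<iota> :: "nat \<Rightarrow> 'n::finite" and d :: nat and M :: int and N :: nat +
  assumes M_le: "M \<le> int d - 2"
begin

text \<open>If \<mu> = \<open>u (d - 1)\<close> were not integral, all of
  \<open>u 1, ..., u (d - 1)\<close> would equal \<mu>. Coordinate \<open>d - 1\<close> is then a
  positive integer, so \<open>M * \<mu> + u (d + N)\<close> is at least 1, while the total exceeds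
  it by at least \<mu>. With \<mu> integral, all coefficients are integral.\<close>

lemma lattice_point_is_vertex:
  assumes "x \<in> simplex_set" "x \<in> lattice_points"
  shows "x \<in> pt ` insert (d + N) {..<d}"
proof -
  obtain u where u: "\<forall>k. 0 \<le> u k" "(\<Sum>k<d. u k) + u (d + N) = 1"
    and x: "x = (\<Sum>k<d. u k *\<^sub>R pt k) + u (d + N) *\<^sub>R pt (d + N)"
    using assms(1) unfolding simplex_set_eq by blast
  have d: "d \<in> {1..d}" "d - 1 \<in> {1..d}" "d - 1 \<noteq> d"
    using d_ge by auto
  have x_int: "x $ \<iota> j \<in> \<int>" if "j \<in> {1..d}" for j
    using assms(2) that by (simp add: lattice_points_iff)
  define \<mu> where "\<mu> = u (d - 1)"
  have last: "real_of_int M * \<mu> + u (d + N) \<in> \<int>"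
    using x_int[OF d(2)] d(3) unfolding x full_combination_nth[OF d(2)] \<mu>_def by simp
  have diff: "u k - \<mu> \<in> \<int>" if "1 \<le> k" "k < d" for k
  proof (cases "k = d - 1")
    case False
    have "x $ \<iota> k - (real_of_int M * \<mu> + u (d + N)) \<in> \<int>"
      using that by (intro Ints_diff x_int last) auto
    moreover have "x $ \<iota> k = u k + (real_of_int M - 1) * \<mu> + u (d + N)"
      using full_combination_nth[of k u] that False unfolding x \<mu>_def by auto
    ultimately show ?thesis
      by (simp add: algebra_simps)
  qed (simp add: \<mu>_def)
  have le1: "u k \<le> 1" if "k < d" for k
  proof -
    have "u k \<le> (\<Sum>k<d. u k)"
      using that u(1) by (intro member_le_sum) auto
    then show ?thesis
      using u by (smt (verit))
  qed
  have \<mu>: "0 \<le> \<mu>" "\<mu> \<le> 1"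
    using u(1) le1[of "d - 1"] d_ge by (auto simp: \<mu>_def)
  have "\<mu> \<in> \<int>"
  proof (rule ccontr)
    assume "\<mu> \<notin> \<int>"
    then have strict: "0 < \<mu>" "\<mu> < 1"
      using \<mu> by (auto simp: less_le)
    have "u k = \<mu>" if k: "1 \<le> k" "k < d" for k
    proof -
      obtain z where "u k - \<mu> = of_int z"
        using diff[OF k] by (auto elim: Ints_cases)
      moreover have "-1 < u k - \<mu>" "u k - \<mu> < 1"
        using u(1) le1[OF k(2)] strict by (smt (verit))+
      ultimately have "z = 0"
        by linarith
      then show ?thesis
        using \<open>u k - \<mu> = of_int z\<close> by simp
    qed
    then have "(\<Sum>k\<in>{1..<d}. u k) = (\<Sum>k\<in>{1..<d}. \<mu>)"
      by (intro sum.cong) auto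
    then have total: "u 0 + (real d - 1) * \<mu> + u (d + N) = 1"
      using u(2) d_ge by (simp add: sum_index_split[of u] of_nat_diff)
    obtain z where z: "real_of_int M * \<mu> + u (d + N) = of_int z"
      using last by (auto elim: Ints_cases)
    have "0 < real_of_int M * \<mu> + u (d + N)"
      using M_ge strict u(1) by (intro add_pos_nonneg) auto
    then have "1 \<le> real_of_int M * \<mu> + u (d + N)"
      unfolding z by simp
    \<comment> \<open>The bound on \<open>M\<close> enters here: the \<open>d - 1\<close> equal
      coefficients outweigh \<open>M * \<mu>\<close> by at least \<mu>, so the total would be above
      1.\<close>
    moreover have "real_of_int M * \<mu> \<le> (real d - 2) * \<mu>"
      using M_le strict by (intro mult_right_mono) linarith+
    ultimately show False
      using total strict u(1)[rule_format, of 0] by (simp add: algebra_simps)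
  qed
  then have ints: "u k \<in> \<int>" if "1 \<le> k" "k < d" for k
    using Ints_add[OF diff[OF that] \<open>\<mu> \<in> \<int>\<close>] by simp
  have "u (d + N) \<in> \<int>"
    using Ints_diff[OF last Ints_mult[OF Ints_of_int[of M] \<open>\<mu> \<in> \<int>\<close>]] by simp
  moreover have "(\<Sum>k\<in>{1..<d}. u k) \<in> \<int>"
    using ints by (intro Ints_sum) auto
  ultimately have "1 - u (d + N) - (\<Sum>k\<in>{1..<d}. u k) \<in> \<int>"
    by (intro Ints_diff) auto
  moreover have "u 0 = 1 - u (d + N) - (\<Sum>k\<in>{1..<d}. u k)"
    using u(2) sum_index_split[of u] by linarith
  ultimately have "u 0 \<in> \<int>"
    by simp
  then have "u k \<in> \<int>" if "k \<in> insert (d + N) {..<d}" for k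
    using ints[of k] \<open>u (d + N) \<in> \<int>\<close> that by (cases "k = 0") auto
  then have n: "real (nat \<lfloor>u k\<rfloor>) = u k" if "k \<in> insert (d + N) {..<d}" for k
    using u(1) that by simp
  have sum: "sum f (insert (d + N) {..<d}) = sum f {..<d} + f (d + N)" for f :: "nat \<Rightarrow> 'b::comm_monoid_add"
    by (simp add: add.commute)
  have "real (\<Sum>k\<in>insert (d + N) {..<d}. nat \<lfloor>u k\<rfloor>) = (\<Sum>k\<in>insert (d + N) {..<d}. u k)"
    unfolding of_nat_sum using n by (intro sum.cong) auto
  then have "real (\<Sum>k\<in>insert (d + N) {..<d}. nat \<lfloor>u k\<rfloor>) = 1"
    using u(2) unfolding sum by simp
  then have "(\<Sum>k\<in>insert (d + N) {..<d}. nat \<lfloor>u k\<rfloor>) = 1"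
    by linarith
  \<comment> \<open>Natural coefficients with sum 1 select a single vertex.\<close>
  from natural_combination_sum[OF _ this, of pt] obtain q where q':
    "\<forall>i\<in>{1..1::nat}. q i \<in> pt ` insert (d + N) {..<d}"
    "(\<Sum>k\<in>insert (d + N) {..<d}. real (nat \<lfloor>u k\<rfloor>) *\<^sub>R pt k) = (\<Sum>i = 1..1. q i)"
    by blast
  have q: "q 1 \<in> pt ` insert (d + N) {..<d}"
    "(\<Sum>k\<in>insert (d + N) {..<d}. real (nat \<lfloor>u k\<rfloor>) *\<^sub>R pt k) = q 1"
    using q'(1) unfolding q'(2) by auto
  have "(\<Sum>k\<in>insert (d + N) {..<d}. real (nat \<lfloor>u k\<rfloor>) *\<^sub>R pt k)
      = (\<Sum>k\<in>insert (d + N) {..<d}. u k *\<^sub>R pt k)"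
    using n by (intro sum.cong) auto
  also have "\<dots> = x"
    unfolding sum x ..
  finally show ?thesis
    using q by simp
qed

section \<open>Obstructions from divisibility of the last coordinate by \<open>N\<close>\<close>

lemma vertex_height:
  assumes "x \<in> pt ` insert (d + N) {..<d}"
  shows "\<exists>z. x $ \<iota> d = of_int (int N * z)"
proof -
  have d: "d \<in> {1..d}"
    using d_ge by simp
  obtain k where k: "x = pt k" "k = d + N \<or> k < d"
    using assms by auto
  from k(2) show ?thesis
  proof
    assume "k = d + N"
    then show ?thesis
      using pt_axis_nth[OF d, of N] k(1) by (intro exI[of _ 1]) simp
  next
    assume "k < d"
    then have "coord k d = 0"
      by (auto simp: coord_def)
    then show ?thesis
      using pt_nth[OF d, of k] k(1) by (intro exI[of _ 0]) simp
  qed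
qed

lemma no_unimodular_triangulation: "\<not> unimodular_triangulation \<T> simplex_set"
proof
  assume uni: "unimodular_triangulation \<T> simplex_set"
  then have union: "\<Union>\<T> = simplex_set"
    by (simp add: unimodular_triangulation_def lattice_triangulation_def)
  \<comment> \<open>Any point of the union supplies a member \<open>T\<close> of the triangulation,
    and one member suffices.\<close>
  have "pt 0 \<in> simplex_set"
    unfolding simplex_set_def using d_ge by (intro hull_inc) auto
  then obtain T where T: "T \<in> \<T>"
    using union by blast
  then have "full_lattice_simplex T" and vol: "normalized_volume T = 1"
    using uni by (auto simp: unimodular_triangulation_def lattice_triangulation_def)
  then obtain C where C: "\<not> affine_dependent C" "int (card C) = int CARD('n) + 1" "T = convex hull C"
    and "{v. v extreme_point_of T} \<subseteq> lattice_points"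
    unfolding full_lattice_simplex_def simplex_def by blast
  then have "C \<subseteq> lattice_points"
    using extreme_point_of_convex_hull_affine_independent[OF C(1)] by blast
  moreover have "C \<subseteq> simplex_set"
    using hull_subset[of C convex] C(3) T union by blast
  ultimately have sub: "C \<subseteq> pt ` insert (d + N) {..<d}"
    using lattice_point_is_vertex by blast
  \<comment> \<open>\<open>C\<close> has \<open>d + 1\<close> elements, all among at most
    \<open>d + 1\<close> vertices, so it contains every vertex.\<close>
  have "card (pt ` insert (d + N) {..<d}) \<le> card (insert (d + N) {..<d})"
    by (rule card_image_le) simp
  then have "card (pt ` insert (d + N) {..<d}) \<le> card C"
    using C(2) d_def by simp
  then have C_eq: "C = pt ` insert (d + N) {..<d}"
    using sub by (intro card_seteq) auto
  have "coord 0 d = 0"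
    by (simp add: coord_def)
  then have zero: "pt 0 $ \<iota> d = 0"
    using d_ge by (simp add: pt_nth)
  have "\<exists>z. normalized_volume (convex hull C) = of_int (int N * z)"
  proof (rule normalized_volume_integer_multiple[of C "pt 0" "\<iota> d"])
    show "finite C"
      by (simp add: C_eq)
    show "card C = Suc CARD('n)"
      using C(2) by linarith
    show "pt 0 \<in> C"
      using d_ge by (auto simp: C_eq)
    show "C \<subseteq> lattice_points"
      by fact
    show "\<exists>z. x $ \<iota> d - pt 0 $ \<iota> d = of_int (int N * z)" if "x \<in> C" for x
      using vertex_height[of x] that unfolding C_eq zero by simp
  qed
  then obtain z where "(1::real) = of_int (int N * z)"
    using vol C(3) by auto
  then have "int N * z = 1"
    by (metis of_int_eq_1_iff)
  then show False
    using N_ge zmult_eq_1_iff by auto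
qed

lemma no_integer_decomposition: "\<not> integer_decomposition_property simplex_set"
proof
  assume idp: "integer_decomposition_property simplex_set"
  define p where "p = pt (d + (N - 1))"
  have d: "d \<in> {1..d}" "1 \<le> d"
    using d_ge by auto
  \<comment> \<open>For \<open>p\<close> = \<open>(1, ..., 1, N - 1)\<close> the last coordinate
    forces the apex coefficient \<open>1 - 1 / N\<close>; the others then require
    \<open>M * \<epsilon>\<close> = \<open>1 / N\<close>.\<close>
  define \<epsilon> where "\<epsilon> = 1 / (real_of_int M * real N)"
  have N: "1 \<le> real N" "0 < real N" and M: "1 \<le> real_of_int M" "0 < real_of_int M"
    using N_ge M_ge by auto
  have \<epsilon>: "0 \<le> \<epsilon>" "\<epsilon> \<le> 1" "real_of_int M * \<epsilon> = 1 / real N"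
  proof -
    have "1 \<le> real_of_int M * real N"
      using mult_mono[OF M(1) N(1)] M by simp
    then show "0 \<le> \<epsilon>" "\<epsilon> \<le> 1" "real_of_int M * \<epsilon> = 1 / real N"
      using M by (simp_all add: \<epsilon>_def)
  qed
  \<comment> \<open>The origin takes up what is missing to the total \<open>d\<close>. Since
    \<epsilon> is at most 1, this remainder is at least \<open>1 / N\<close>, so the dilation factor
    \<open>d\<close> is large enough.\<close>
  define u where "u k = (if k = 0 then real d - (real d - 1) * \<epsilon> - (1 - 1 / real N)
      else if k < d then \<epsilon> else 1 - 1 / real N)" for k
  have u_top: "u (d + N) = 1 - 1 / real N"
    using d_ge by (simp add: u_def)
  have u_base: "u k = \<epsilon>" if "1 \<le> k" "k < d" for k
    using that by (simp add: u_def)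
  have "(\<Sum>k\<in>{1..<d}. u k) = (\<Sum>k\<in>{1..<d}. \<epsilon>)"
    using u_base by (intro sum.cong) auto
  also have "\<dots> = (real d - 1) * \<epsilon>"
    using d_ge by (simp add: of_nat_diff)
  finally have total: "(\<Sum>k<d. u k) + u (d + N) = real d"
    unfolding sum_index_split[of u] u_top by (simp add: u_def)
  have "(real d - 1) * \<epsilon> \<le> real d - 1"
    using \<epsilon> d_ge by (intro mult_left_le) auto
  moreover have "0 \<le> 1 / real N" "1 / real N \<le> 1"
    using N by simp_all
  moreover have "0 \<le> D - x - (1 - r)" if "x \<le> D - 1" "0 \<le> r" for D x r :: real
    using that by linarith
  ultimately have "0 \<le> real d - (real d - 1) * \<epsilon> - (1 - 1 / real N)" "0 \<le> 1 - 1 / real N"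
    by (blast, simp)
  then have nonneg: "0 \<le> u k" for k
    using \<epsilon>(1) by (auto simp only: u_def split: if_split)
  have p_eq: "p = (\<Sum>k<d. u k *\<^sub>R pt k) + u (d + N) *\<^sub>R pt (d + N)"
  proof (rule vec_eqI)
    fix j
    assume j: "j \<in> {1..d}"
    have "u (d - 1) = \<epsilon>"
      using d_ge by (intro u_base) auto
    moreover have "u j = \<epsilon>" if "j \<noteq> d"
      using that j by (intro u_base) auto
    moreover have "real N * (1 - 1 / real N) = real (N - 1)"
      using N_ge by (simp add: of_nat_diff algebra_simps)
    ultimately show "p $ \<iota> j = ((\<Sum>k<d. u k *\<^sub>R pt k) + u (d + N) *\<^sub>R pt (d + N)) $ \<iota> j"
      unfolding full_combination_nth[OF j] p_def pt_axis_nth[OF j] unfolding u_top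
      using \<epsilon>(3) by (auto simp: left_diff_distrib)
  qed
  define w where "w k = u k / real d" for k
  have "(\<Sum>k<d. w k) + w (d + N) = ((\<Sum>k<d. u k) + u (d + N)) / real d"
    by (simp add: w_def sum_divide_distrib add_divide_distrib)
  then have "(\<Sum>k<d. w k) + w (d + N) = 1"
    using total d_ge by simp
  moreover have "\<forall>k. 0 \<le> w k"
    using nonneg by (simp add: w_def)
  ultimately have "(\<Sum>k<d. w k *\<^sub>R pt k) + w (d + N) *\<^sub>R pt (d + N) \<in> simplex_set"
    unfolding simplex_set_eq by blast
  moreover have "p = real d *\<^sub>R ((\<Sum>k<d. w k *\<^sub>R pt k) + w (d + N) *\<^sub>R pt (d + N))"
    unfolding p_eq using d_ge by (simp add: w_def scaleR_sum_right scaleR_add_right)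
  ultimately have "p \<in> (\<lambda>x. real d *\<^sub>R x) ` simplex_set"
    by blast
  moreover have "p \<in> lattice_points"
    unfolding p_def by (rule pt_lattice)
  ultimately have "p \<in> (\<lambda>x. real d *\<^sub>R x) ` simplex_set \<inter> lattice_points"
    by blast
  then obtain q where q: "\<forall>i\<in>{1..d}. q i \<in> simplex_set \<inter> lattice_points" "p = (\<Sum>i = 1..d. q i)"
    using idp d(2) unfolding integer_decomposition_property_def by blast
  have "\<forall>i\<in>{1..d}. \<exists>z. q i $ \<iota> d = of_int (int N * z)"
    using q(1) lattice_point_is_vertex vertex_height by blast
  then obtain z where z: "\<And>i. i \<in> {1..d} \<Longrightarrow> q i $ \<iota> d = of_int (int N * z i)"
    by metis
  have "p $ \<iota> d = (\<Sum>i = 1..d. q i $ \<iota> d)"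
    unfolding q(2) by simp
  also have "\<dots> = (\<Sum>i = 1..d. of_int (int N * z i))"
    using z by (intro sum.cong) auto
  also have "\<dots> = of_int (int N * (\<Sum>i = 1..d. z i))"
    by (simp add: sum_distrib_left)
  finally have "real (N - 1) = of_int (int N * (\<Sum>i = 1..d. z i))"
    unfolding p_def pt_axis_nth[OF d(1)] by simp
  then have "int (N - 1) = int N * (\<Sum>i = 1..d. z i)"
    by (metis of_int_eq_iff of_int_of_nat_eq)
  \<comment> \<open>This is impossible because \<open>0 < N - 1 < N\<close>.\<close>
  then have "int N dvd int (N - 1)"
    by simp
  then show False
    using N_ge zdvd_imp_le[of "int N" "int (N - 1)"] by auto
qed

end

theorem corollary5p9:
  fixes \<iota> :: "nat \<Rightarrow> 'n::finite" and d :: nat and M N :: int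
    and a b :: "nat \<Rightarrow> int" and S :: "(real ^ 'n) set"
  assumes d_def: "d = CARD('n)"
    and numbering: "bij_betw \<iota> {1..d} UNIV"
    and d_ge: "2 \<le> d"
    and M_ge: "1 \<le> M" and M_le: "M \<le> int d"
    and N_ge: "2 \<le> N"
    and a_def: "a = (\<lambda>i. if i = d then N else 1)"
    and b_def: "b = (\<lambda>i. if i = d then 0 else if i = d - 1 then M else M - 1)"
    and S_def: "S = two_row_hnf_simplex \<iota> a b"
  shows "(M \<in> {int d - 1, int d} \<longleftrightarrow> (\<exists>\<T>. unimodular_triangulation \<T> S)) \<and>
         ((\<exists>\<T>. unimodular_triangulation \<T> S) \<longleftrightarrow> integer_decomposition_property S)"
proof -
  \<comment> \<open>The locales take a natural number here because the apex is \<open>pt\<close> at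
    index \<open>d + N\<close>.\<close>
  define n where "n = nat N"
  have N: "N = int n" "2 \<le> n"
    using N_ge by (auto simp: n_def)
  interpret hnf_simplex \<iota> d M n
    by unfold_locales (use d_def numbering d_ge M_ge N(2) in auto)
  have S: "S = simplex_set"
    unfolding S_def a_def b_def N(1) by (rule two_row_hnf_simplex_eq)
  show ?thesis
  proof (cases "M \<in> {int d - 1, int d}")
    case True
    then interpret balanced_hnf_simplex \<iota> d M n
      by unfold_locales auto
    show ?thesis
      using True unimodular_triangulation_exists integer_decomposition unfolding S by blast
  next
    case False
    then interpret sparse_hnf_simplex \<iota> d M n
      by unfold_locales (use M_le in auto)
    show ?thesis
      using False no_unimodular_triangulation no_integer_decomposition unfolding S by blast
  qed
qed

end
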